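(* Let $\Gamma$ be a zero-sum semidefinite network game on an undirected graph $G=([N],E)$ with strategy sets $\mathcal{X}_i=\mathrm{D}(\mathcal{A}_i)$ ($i\in[N]$), $\mathcal{X}=\prod_{i=1}^N\mathcal{X}_i$, and payoff operators $\Phi_{ij}$, and let $\mathrm{NE}(\Gamma)\subseteq\mathcal{X}$ be its set of Nash equilibria. Let $P^*(\Gamma)$ be the set of optimal solutions $(w,X)$, $w=(w_1,\dots,w_N)$, $X=(X_1,\dots,X_N)$, of the semidefinite program $$\begin{array}{rl}\min\limits_{w,X} & \sum_{i\in[N]} w_i\\ \text{s.t.} & w_i\,\mathbb{I}_{\mathcal{A}_i}\succeq \Phi_i(X_{N(i)}),\quad i\in[N],\\ & \operatorname{tr}(X_i)=1,\quad i\in[N],\\ & X_i\succeq 0,\quad i\in[N],\\ & w\in\mathbb{R}^N,\end{array}$$ where $\Phi_i(X_{N(i)})=\sum_{j\in N(i)}\Phi_{ij}(X_j)$. Then the set of Nash equilibria is the coordinate projection of $P^*(\Gamma)$ onto the $X$ coordinates, i.e. $$\mathrm{NE}(\Gamma)=\{X\in\mathcal{X} : \exists\, w\in\mathbb{R}^N \text{ with } (w,X)\in P^*(\Gamma)\}.$$ In particular, the set of Nash equilibria of a zero-sum semidefinite network game is SDP-representable.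
   Context: $[N]=\{1,\dots,N\}$. A complex Euclidean space $\mathcal{A}$ is a finite-dimensional complex inner product space $\mathbb{C}^k$, $k\ge1$; $L(\mathcal{A})$ is the space of linear maps $\mathcal{A}\to\mathcal{A}$, $\mathrm{Herm}(\mathcal{A})$ the Hermitian ones, $\mathbb{I}_{\mathcal{A}}$ the identity; $A\succeq B$ means that $A-B$ is Hermitian positive semidefinite; $\langle A,B\rangle=\operatorname{tr}(A^\dagger B)$. $\mathrm{D}(\mathcal{A})=\{X\in\mathrm{Herm}(\mathcal{A}): X\succeq0,\ \operatorname{tr}(X)=1\}$ is the set of density matrices. Semidefinite network game: an $N$-player game on an undirected graph $G=([N],E)$. Player $i$'s strategy set is $\mathcal{X}_i=\mathrm{D}(\mathcal{A}_i)$ for a complex Euclidean space $\mathcal{A}_i$; $\mathcal{X}=\prod_i\mathcal{X}_i$. For each edge $(i,j)\in E$ there are Hermitian matrices $R_{ij},R_{ji}\in\mathrm{Herm}(\mathcal{A}_i\otimes\mathcal{A}_j)$; in the two-player game on this edge the payoff of $i$ is $p_{i,j}=\langle R_{ij},X_i\otimes X_j\rangle$ and the payoff of $j$ is $p_{j,i}=\langle R_{ji},X_i\otimes X_j\rangle$. Each player uses a single density matrix in all of its edge games, and the payoff of player $i$ at $X=(X_1,\dots,X_N)\in\mathcal{X}$ is $p_i(X)=\sum_{j\in N(i)}p_{i,j}(X_i,X_j)$, where $N(i)$ is the set of neighbors of $i$. Write $X_{N(i)}=(X_j:j\in N(i))$ and $X_{-i}=(X_j)_{j\ne i}$. Payoff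 operators: for each ordered pair of adjacent players $(i,j)$, $\Phi_{ij}:L(\mathcal{A}_j)\to L(\mathcal{A}_i)$ is the linear map with $p_{i,j}(X_i,X_j)=\langle X_i,\Phi_{ij}(X_j)\rangle$ for all strategies $X_i,X_j$. The game is zero-sum if $\sum_{i=1}^N p_i(X)=0$ for all $X\in\mathcal{X}$. $X\in\mathcal{X}$ is a Nash equilibrium if for every $i\in[N]$, $X_i\in\arg\max\{p_i(Y_i,X_{-i}):Y_i\in\mathcal{X}_i\}$. A spectrahedron is the feasible region of a semidefinite program; a set is SDP-representable if it is a projection of a spectrahedron. *)

theory Defs
  imports
    Complex_Main
    "HOL-Library.FuncSet"
    "Jordan_Normal_Form.Schur_Decomposition"
    "Graph_Theory.Pair_Digraph"
begin

section \<open>Matrices\<close>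

text \<open>
  The operator space of a complex Euclidean space of dimension n is
  \<^term>\<open>carrier_mat n n :: complex mat set\<close>; the adjoint is \<^const>\<open>mat_adjoint\<close>.
\<close>

definition mat_trace :: "complex mat \<Rightarrow> complex" where
  "mat_trace A = (\<Sum>i<dim_row A. A $$ (i, i))"

definition mat_inner :: "complex mat \<Rightarrow> complex mat \<Rightarrow> complex" where
  "mat_inner A B = mat_trace (mat_adjoint A * B)"

text \<open>The row (or column) index (a, b) of the Kronecker product is encoded as \<open>a * dim B + b\<close>.\<close>

definition tensor :: "complex mat \<Rightarrow> complex mat \<Rightarrow> complex mat" (infixr \<open>\<otimes>\<^sub>m\<close> 71) where
  "A \<otimes>\<^sub>m B = mat (dim_row A * dim_row B) (dim_col A * dim_col B)
     (\<lambda>(r, c). A $$ (r div dim_row B, c div dim_col B) * B $$ (r mod dim_row B, c mod dim_col B))"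

definition Herm :: "nat \<Rightarrow> complex mat set" where
  "Herm n = {A \<in> carrier_mat n n. mat_adjoint A = A}"

text \<open>The order on \<^typ>\<open>complex\<close> is that of \<open>Complex_Order\<close>: \<open>0 \<le> z\<close> says that z is real and
  nonnegative.\<close>

definition psd :: "complex mat \<Rightarrow> bool" where
  "psd A \<longleftrightarrow> A \<in> Herm (dim_row A) \<and> (\<forall>v \<in> carrier_vec (dim_row A). 0 \<le> (A *\<^sub>v v) \<bullet>c v)"

definition psd_ge :: "complex mat \<Rightarrow> complex mat \<Rightarrow> bool" (infix \<open>\<succeq>\<close> 50) where
  "A \<succeq> B \<longleftrightarrow> psd (A - B)"

definition density :: "nat \<Rightarrow> complex mat set" where
  "density n = {X \<in> Herm n. X \<succeq> 0\<^sub>m n n \<and> mat_trace X = 1}"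

text \<open>Finite sums of n by n matrices; the size n is explicit so that the empty sum makes sense.\<close>

definition sqmat_sum :: "nat \<Rightarrow> 'i set \<Rightarrow> ('i \<Rightarrow> complex mat) \<Rightarrow> complex mat" where
  "sqmat_sum n I F = mat n n (\<lambda>rc. \<Sum>i\<in>I. F i $$ rc)"

definition op_linear :: "nat \<Rightarrow> nat \<Rightarrow> (complex mat \<Rightarrow> complex mat) \<Rightarrow> bool" where
  "op_linear n m F \<longleftrightarrow>
     F \<in> carrier_mat n n \<rightarrow> carrier_mat m m \<and>
     (\<forall>X \<in> carrier_mat n n. \<forall>Y \<in> carrier_mat n n. F (X + Y) = F X + F Y) \<and>
     (\<forall>c. \<forall>X \<in> carrier_mat n n. F (c \<cdot>\<^sub>m X) = c \<cdot>\<^sub>m F X)"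


section \<open>Semidefinite network games\<close>

text \<open>
  An undirected graph is a simple graph in the sense of \<^locale>\<open>pair_graph\<close>, which stores an edge
  as a pair of opposite arcs. For an edge {i, j} with i < j, both \<open>payoff_mat \<Gamma> i j\<close> and
  \<open>payoff_mat \<Gamma> j i\<close> act on the tensor product with the factor of i on the left.
\<close>

record sdp_network_game =
  num_players :: nat
  game_graph :: "nat pair_pre_digraph"
  strat_dim :: "nat \<Rightarrow> nat"
  payoff_mat :: "nat \<Rightarrow> nat \<Rightarrow> complex mat"

definition players :: "sdp_network_game \<Rightarrow> nat set" where
  "players \<Gamma> = {1..num_players \<Gamma>}"

definition neighbors :: "sdp_network_game \<Rightarrow> nat \<Rightarrow> nat set" where
  "neighbors \<Gamma> i = {j. (i, j) \<in> parcs (game_graph \<Gamma>)}"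

definition semidefinite_network_game :: "sdp_network_game \<Rightarrow> bool" where
  "semidefinite_network_game \<Gamma> \<longleftrightarrow>
     pair_graph (game_graph \<Gamma>) \<and>
     pverts (game_graph \<Gamma>) = players \<Gamma> \<and>
     (\<forall>i \<in> players \<Gamma>. 1 \<le> strat_dim \<Gamma> i) \<and>
     (\<forall>(i, j) \<in> parcs (game_graph \<Gamma>). payoff_mat \<Gamma> i j \<in> Herm (strat_dim \<Gamma> i * strat_dim \<Gamma> j))"

definition strategies :: "sdp_network_game \<Rightarrow> nat \<Rightarrow> complex mat set" where
  "strategies \<Gamma> i = density (strat_dim \<Gamma> i)"

definition profiles :: "sdp_network_game \<Rightarrow> (nat \<Rightarrow> complex mat) set" where
  "profiles \<Gamma> = (\<Pi>\<^sub>E i \<in> players \<Gamma>. strategies \<Gamma> i)"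

text \<open>
  \<open>edge_payoff \<Gamma> i j A B\<close> is the payoff of i in the game on {i, j} when i plays A and j plays B.
  Taking the real part loses nothing, since all matrices involved are Hermitian.
\<close>

definition edge_payoff :: "sdp_network_game \<Rightarrow> nat \<Rightarrow> nat \<Rightarrow> complex mat \<Rightarrow> complex mat \<Rightarrow> real" where
  "edge_payoff \<Gamma> i j A B = Re (mat_inner (payoff_mat \<Gamma> i j) (if i < j then A \<otimes>\<^sub>m B else B \<otimes>\<^sub>m A))"

definition payoff :: "sdp_network_game \<Rightarrow> nat \<Rightarrow> (nat \<Rightarrow> complex mat) \<Rightarrow> real" where
  "payoff \<Gamma> i X = (\<Sum>j \<in> neighbors \<Gamma> i. edge_payoff \<Gamma> i j (X i) (X j))"

definition zero_sum :: "sdp_network_game \<Rightarrow> bool" where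
  "zero_sum \<Gamma> \<longleftrightarrow> (\<forall>X \<in> profiles \<Gamma>. (\<Sum>i \<in> players \<Gamma>. payoff \<Gamma> i X) = 0)"

definition nash_equilibria :: "sdp_network_game \<Rightarrow> (nat \<Rightarrow> complex mat) set" where
  "nash_equilibria \<Gamma> =
     {X \<in> profiles \<Gamma>. \<forall>i \<in> players \<Gamma>. \<forall>Y \<in> strategies \<Gamma> i. payoff \<Gamma> i (X(i := Y)) \<le> payoff \<Gamma> i X}"

text \<open>
  The payoff operators are given by their defining property, which determines \<open>\<Phi> i j\<close> on
  \<^term>\<open>carrier_mat (strat_dim \<Gamma> j) (strat_dim \<Gamma> j)\<close> because density matrices span that space over
  the complex numbers.
\<close>

definition payoff_operators ::
    "sdp_network_game \<Rightarrow> (nat \<Rightarrow> nat \<Rightarrow> complex mat \<Rightarrow> complex mat) \<Rightarrow> bool" where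
  "payoff_operators \<Gamma> \<Phi> \<longleftrightarrow>
     (\<forall>(i, j) \<in> parcs (game_graph \<Gamma>).
        op_linear (strat_dim \<Gamma> j) (strat_dim \<Gamma> i) (\<Phi> i j) \<and>
        (\<forall>A \<in> strategies \<Gamma> i. \<forall>B \<in> strategies \<Gamma> j.
           complex_of_real (edge_payoff \<Gamma> i j A B) = mat_inner A (\<Phi> i j B)))"

definition total_operator ::
    "sdp_network_game \<Rightarrow> (nat \<Rightarrow> nat \<Rightarrow> complex mat \<Rightarrow> complex mat) \<Rightarrow> nat \<Rightarrow> (nat \<Rightarrow> complex mat) \<Rightarrow> complex mat"
  where
  "total_operator \<Gamma> \<Phi> i X = sqmat_sum (strat_dim \<Gamma> i) (neighbors \<Gamma> i) (\<lambda>j. \<Phi> i j (X j))"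


section \<open>The semidefinite program of a game\<close>

definition sdp_feasible ::
    "sdp_network_game \<Rightarrow> (nat \<Rightarrow> nat \<Rightarrow> complex mat \<Rightarrow> complex mat) \<Rightarrow> ((nat \<Rightarrow> real) \<times> (nat \<Rightarrow> complex mat)) set"
  where
  "sdp_feasible \<Gamma> \<Phi> =
     {(w, X). w \<in> players \<Gamma> \<rightarrow>\<^sub>E UNIV \<and> X \<in> (\<Pi>\<^sub>E i \<in> players \<Gamma>. Herm (strat_dim \<Gamma> i)) \<and>
        (\<forall>i \<in> players \<Gamma>.
           complex_of_real (w i) \<cdot>\<^sub>m 1\<^sub>m (strat_dim \<Gamma> i) \<succeq> total_operator \<Gamma> \<Phi> i X \<and>
           mat_trace (X i) = 1 \<and>
           X i \<succeq> 0\<^sub>m (strat_dim \<Gamma> i) (strat_dim \<Gamma> i))}"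

definition sdp_optimal ::
    "sdp_network_game \<Rightarrow> (nat \<Rightarrow> nat \<Rightarrow> complex mat \<Rightarrow> complex mat) \<Rightarrow> ((nat \<Rightarrow> real) \<times> (nat \<Rightarrow> complex mat)) set"
  where
  "sdp_optimal \<Gamma> \<Phi> =
     {(w, X) \<in> sdp_feasible \<Gamma> \<Phi>.
        \<forall>(w', X') \<in> sdp_feasible \<Gamma> \<Phi>. (\<Sum>i \<in> players \<Gamma>. w i) \<le> (\<Sum>i \<in> players \<Gamma>. w' i)}"


section \<open>Spectrahedra\<close>

definition herm_linear :: "nat \<Rightarrow> nat \<Rightarrow> (complex mat \<Rightarrow> complex mat) \<Rightarrow> bool" where
  "herm_linear n m F \<longleftrightarrow>
     F \<in> Herm n \<rightarrow> Herm m \<and>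
     (\<forall>X \<in> Herm n. \<forall>Y \<in> Herm n. F (X + Y) = F X + F Y) \<and>
     (\<forall>c::real. \<forall>X \<in> Herm n. F (complex_of_real c \<cdot>\<^sub>m X) = complex_of_real c \<cdot>\<^sub>m F X)"

text \<open>
  The variables of a semidefinite program are finitely many Hermitian matrices Z l of size n l
  (\<open>l \<in> I\<close>); a real scalar variable is a Hermitian matrix of size 1. The feasible region is cut out
  by finitely many linear matrix inequalities and finitely many real linear equations.
\<close>

definition spectrahedron :: "nat set \<Rightarrow> (nat \<Rightarrow> nat) \<Rightarrow> (nat \<Rightarrow> complex mat) set \<Rightarrow> bool" where
  "spectrahedron I n S \<longleftrightarrow> finite I \<and>
     (\<exists>(K::nat) (q :: nat \<Rightarrow> nat) (L :: nat \<Rightarrow> nat \<Rightarrow> complex mat \<Rightarrow> complex mat) (C :: nat \<Rightarrow> complex mat)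
       (M::nat) (A :: nat \<Rightarrow> nat \<Rightarrow> complex mat) (b :: nat \<Rightarrow> real).
        (\<forall>k<K. C k \<in> Herm (q k) \<and> (\<forall>l\<in>I. herm_linear (n l) (q k) (L k l))) \<and>
        (\<forall>m<M. \<forall>l\<in>I. A m l \<in> Herm (n l)) \<and>
        S = {Z \<in> (\<Pi>\<^sub>E l\<in>I. Herm (n l)).
               (\<forall>k<K. sqmat_sum (q k) I (\<lambda>l. L k l (Z l)) \<succeq> C k) \<and>
               (\<forall>m<M. (\<Sum>l\<in>I. mat_inner (A m l) (Z l)) = complex_of_real (b m))})"

text \<open>The projection forgets the variables Z l with \<open>l \<in> J - I\<close>.\<close>

definition sdp_representable :: "nat set \<Rightarrow> (nat \<Rightarrow> nat) \<Rightarrow> (nat \<Rightarrow> complex mat) set \<Rightarrow> bool" where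
  "sdp_representable I n S \<longleftrightarrow>
     (\<exists>J n' T. I \<subseteq> J \<and> (\<forall>l\<in>I. n' l = n l) \<and> spectrahedron J n' T \<and>
        S = (\<lambda>Z. restrict Z I) ` T)"

end

theory Submission
  imports Defs
begin

text \<open>
  Consider the total payoff \<open>cross_payoff Y X\<close> when every player i deviates to \<open>Y i\<close> while its neighbours
  follow X. It is bilinear in the two profiles, and the zero-sum condition says that it vanishes for
  Y = X; polarization makes it skew-symmetric (\<open>cross_payoff_skew\<close>). So the network game is a symmetric
  two-player zero-sum game on the convex compact set of profiles, whose value is zero: for every
  \<open>\<epsilon> > 0\<close> there is a profile X against which no profile earns more than \<open>\<epsilon>\<close> in total
  (\<open>near_optimal_profile\<close>). For finitely many profiles this is the minimax theorem for a skew matrix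
  (\<open>skew_game_near_equilibrium\<close>), proved by an elementary averaging dynamics; a finite net of the
  profiles reduces the general case to it. Approximate solutions are enough, because only the infimum
  of the program is at stake.

  In the program, \<open>w i * 1 \<succeq> \<Phi>\<^sub>i(X)\<close> says that w i bounds every payoff that player i can reach against X
  (\<open>sdp_feasible_iff\<close>). This rests on the duality between density matrices and the semidefinite order,
  whose main ingredient is that the trace of a product of two positive semidefinite matrices is
  nonnegative (\<open>pos_form_pairing_nonneg\<close>). Since the payoffs at X are bounded by w and sum to zero,
  feasible values are nonnegative; by the minimax theorem their infimum is zero. Hence (w, X) is
  optimal exactly when it is feasible with value zero (\<open>optimal_iff_value_zero\<close>), and then w must be the
  vector of payoffs at X, which is to say that X is an equilibrium (\<open>nash_iff_feasible_value_zero\<close>).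

  The same characterisation exhibits the equilibria as a projection of a spectrahedron: adding the
  equation \<open>\<Sum> w i = 0\<close> to the constraints of the program removes the minimisation, and each w i
  becomes a Hermitian block of size 1 (\<open>equilibrium_spectrahedron_iff\<close>).
\<close>

section \<open>Skew-symmetric matrix games\<close>

text \<open>
  This is the minimax theorem for a symmetric zero-sum game with finitely many pure strategies, in
  approximate form, proved by a repeated-play argument of Brown, von Neumann and Blackwell. Given a
  mixture p, let q be the vector of its positive excess payoffs, that is, of the gains of the pure
  strategies against p where these are positive. Moving p a fraction t towards the normalised q
  scales the old excess by 1 - t and adds t times the payoff vector of q; that vector is orthogonal
  to q by skew symmetry, so the squared norm of the excess goes from Pot to at most
  \<open>(1 - t)\<^sup>2 * Pot + t\<^sup>2 * B\<close>. With t = 1 / (n + 1) in round n this decays like B / n.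
\<close>

lemma skew_game_near_equilibrium:
  fixes M :: "'a \<Rightarrow> 'a \<Rightarrow> real"
  assumes fin: "finite F" and ne: "F \<noteq> {}"
    and skew: "\<forall>k\<in>F. \<forall>l\<in>F. M k l = - M l k"
    and eps: "0 < \<epsilon>"
  shows "\<exists>p. (\<forall>k\<in>F. 0 \<le> p k) \<and> sum p F = 1 \<and> (\<forall>k\<in>F. (\<Sum>l\<in>F. M k l * p l) \<le> \<epsilon>)"
proof -
  define B where "B = (\<Sum>k\<in>F. (\<Sum>l\<in>F. \<bar>M k l\<bar>)\<^sup>2)"
  define g where "g p k = (\<Sum>l\<in>F. M k l * p l)" for p k
  define q where "q p k = max 0 (g p k)" for p k
  define Pot where "Pot p = (\<Sum>k\<in>F. (q p k)\<^sup>2)" for p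
  have g_bound: "(\<Sum>k\<in>F. (g y k)\<^sup>2) \<le> B" if y: "\<And>k. k \<in> F \<Longrightarrow> 0 \<le> y k" "sum y F = 1" for y
  proof -
    have y1: "y k \<le> 1" if "k \<in> F" for k
      using member_le_sum[of k F y] that y fin by auto
    have "\<bar>g y k\<bar> \<le> (\<Sum>l\<in>F. \<bar>M k l\<bar>)" for k
    proof -
      have "\<bar>g y k\<bar> \<le> (\<Sum>l\<in>F. \<bar>M k l * y l\<bar>)"
        unfolding g_def by (rule sum_abs)
      also have "\<dots> \<le> (\<Sum>l\<in>F. \<bar>M k l\<bar>)"
        using y y1 by (intro sum_mono) (simp add: abs_mult mult_left_le)
      finally show ?thesis .
    qed
    then show ?thesis
      unfolding B_def by (intro sum_mono) (metis abs_ge_zero power2_abs power_mono)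
  qed
  have step: "\<exists>p. (\<forall>k\<in>F. 0 \<le> p k) \<and> sum p F = 1 \<and> real n * Pot p \<le> B" for n
  proof (induction n)
    case 0
    obtain k0 where "k0 \<in> F" using ne by auto
    then have "sum (\<lambda>k. if k = k0 then 1 else (0::real)) F = 1"
      using fin by simp
    moreover have "0 \<le> B" unfolding B_def by (simp add: sum_nonneg)
    ultimately show ?case
      by (intro exI[of _ "\<lambda>k. if k = k0 then 1 else (0::real)"]) auto
  next
    case (Suc n)
    then obtain p where p: "\<And>k. k \<in> F \<Longrightarrow> 0 \<le> p k" "sum p F = 1" "real n * Pot p \<le> B" by auto
    define s where "s = sum (q p) F"
    have q0: "0 \<le> q p k" for k by (simp add: q_def)
    show ?case
    proof (cases "s = 0")
      case True
      then have "q p k = 0" if "k \<in> F" for k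
        using that fin q0 unfolding s_def by (simp add: sum_nonneg_eq_0_iff)
      then have "Pot p = 0" unfolding Pot_def by simp
      moreover have "0 \<le> B" unfolding B_def by (simp add: sum_nonneg)
      ultimately show ?thesis using p by (intro exI[of _ p]) auto
    next
      case False
      then have s: "s > 0" using q0 unfolding s_def by (metis less_eq_real_def sum_nonneg)
      define y where "y k = q p k / s" for k
      have y: "\<And>k. k \<in> F \<Longrightarrow> 0 \<le> y k" "sum y F = 1"
        using q0 s unfolding y_def by (auto simp: s_def simp flip: sum_divide_distrib)
      \<comment> \<open>With this step size, (n + 1) * (1 - t) = n, so n * Pot stays below B.\<close>
      define t where "t = 1 / (real n + 1)"
      have t: "0 \<le> t" "t \<le> 1" by (auto simp: t_def)
      define p' where "p' k = (1 - t) * p k + t * y k" for k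
      have p': "\<And>k. k \<in> F \<Longrightarrow> 0 \<le> p' k" "sum p' F = 1"
        using p y t unfolding p'_def by (auto simp: sum.distrib simp flip: sum_distrib_left)
      have g': "g p' k = (1 - t) * g p k + t * g y k" for k
        unfolding g_def p'_def by (simp add: sum_distrib_left sum.distrib algebra_simps sum_subtractf)
      \<comment> \<open>The quadratic form of a skew matrix vanishes; here it is evaluated at q.\<close>
      have orth: "(\<Sum>k\<in>F. q p k * g y k) = 0"
      proof -
        let ?S = "\<Sum>k\<in>F. \<Sum>l\<in>F. q p k * M k l * q p l"
        have "?S = (\<Sum>l\<in>F. \<Sum>k\<in>F. q p k * M k l * q p l)" by (rule sum.swap)
        also have "\<dots> = (\<Sum>l\<in>F. \<Sum>k\<in>F. - (q p l * M l k * q p k))"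
        proof (intro sum.cong refl)
          fix l k
          assume "l \<in> F" "k \<in> F"
          then have "M k l = - M l k" using skew by blast
          then show "q p k * M k l * q p l = - (q p l * M l k * q p k)" by simp
        qed
        also have "\<dots> = - ?S" by (simp add: sum_negf)
        finally have "?S = 0" by simp
        moreover have "(\<Sum>k\<in>F. q p k * g y k) = ?S / s"
          unfolding g_def y_def by (simp add: sum_distrib_left sum_divide_distrib mult.assoc)
        ultimately show ?thesis by simp
      qed
      \<comment> \<open>Replacing g by its positive part q in the old payoff can only increase the new positive part.\<close>
      have "(q p' k)\<^sup>2 \<le> ((1 - t) * q p k + t * g y k)\<^sup>2" for k
      proof -
        have "(1 - t) * g p k \<le> (1 - t) * q p k"
          using t by (intro mult_left_mono) (auto simp: q_def)
        then have "q p' k \<le> \<bar>(1 - t) * q p k + t * g y k\<bar>"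
          unfolding q_def[of p'] g' by auto
        then show ?thesis
          by (metis q_def max.cobounded1 power2_abs power_mono)
      qed
      then have "Pot p' \<le> (\<Sum>k\<in>F. ((1 - t) * q p k + t * g y k)\<^sup>2)"
        unfolding Pot_def by (rule sum_mono)
      also have "\<dots> = (1 - t)\<^sup>2 * Pot p + 2 * t * (1 - t) * (\<Sum>k\<in>F. q p k * g y k)
          + t\<^sup>2 * (\<Sum>k\<in>F. (g y k)\<^sup>2)"
        unfolding Pot_def sum_distrib_left sum.distrib[symmetric]
        by (intro sum.cong refl) (simp add: power2_eq_square algebra_simps)
      also have "\<dots> \<le> (1 - t)\<^sup>2 * Pot p + t\<^sup>2 * B"
        using orth g_bound[OF y] by (simp add: mult_left_mono)
      finally have le: "Pot p' \<le> (1 - t)\<^sup>2 * Pot p + t\<^sup>2 * B" .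
      have nt: "(real n + 1) * (1 - t) = real n" "(real n + 1) * t = 1"
        by (simp_all add: t_def field_simps)
      have "(real n + 1)\<^sup>2 * Pot p' \<le> (real n + 1)\<^sup>2 * ((1 - t)\<^sup>2 * Pot p + t\<^sup>2 * B)"
        using le by (intro mult_left_mono) auto
      also have "\<dots> = ((real n + 1) * (1 - t))\<^sup>2 * Pot p + ((real n + 1) * t)\<^sup>2 * B"
        unfolding power_mult_distrib by (simp add: algebra_simps)
      also have "\<dots> = real n * (real n * Pot p) + B"
        using nt by (simp add: power2_eq_square)
      also have "\<dots> \<le> real n * B + B"
        using p(3) by (simp add: mult_left_mono)
      finally have "(real n + 1) * ((real n + 1) * Pot p') \<le> (real n + 1) * B"
        by (simp add: power2_eq_square algebra_simps)
      then have "(real n + 1) * Pot p' \<le> B"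
        by (rule mult_left_le_imp_le) simp
      then show ?thesis
        using p' by (intro exI[of _ p']) (auto simp: add.commute)
    qed
  qed
  obtain n :: nat where n: "real n > B / \<epsilon>\<^sup>2" using reals_Archimedean2 by blast
  obtain p where p: "\<And>k. k \<in> F \<Longrightarrow> 0 \<le> p k" "sum p F = 1" "real n * Pot p \<le> B"
    using step by blast
  have "(\<Sum>l\<in>F. M k l * p l) \<le> \<epsilon>" if k: "k \<in> F" for k
  proof (rule ccontr)
    assume "\<not> ?thesis"
    then have gt: "\<epsilon> < g p k" by (simp add: g_def)
    have "\<epsilon>\<^sup>2 \<le> (q p k)\<^sup>2"
      using gt eps by (intro power_mono) (auto simp: q_def)
    also have "\<dots> \<le> Pot p"
      unfolding Pot_def by (rule member_le_sum) (use k fin in auto)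
    finally have "real n * \<epsilon>\<^sup>2 \<le> B"
      using p(3) by (meson mult_left_mono of_nat_0_le_iff order_trans)
    moreover have "B < real n * \<epsilon>\<^sup>2"
      using n eps by (simp add: field_simps)
    ultimately show False by simp
  qed
  with p show ?thesis by blast
qed

section \<open>Positive semidefinite forms\<close>

text \<open>
  The value \<open>\<Sum> a i j * v j * cnj (v i)\<close> is \<open>(A *\<^sub>v v) \<bullet>c v\<close> for the matrix A with entries a. Entries and
  vectors are plain functions here, so that rank-one corrections and unit vectors can be written
  down directly; only the values at indices below n matter.
\<close>

definition herm_form :: "nat \<Rightarrow> (nat \<Rightarrow> nat \<Rightarrow> complex) \<Rightarrow> (nat \<Rightarrow> complex) \<Rightarrow> complex" where
  "herm_form n a v = (\<Sum>i<n. \<Sum>j<n. a i j * v j * cnj (v i))"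

definition pos_form :: "nat \<Rightarrow> (nat \<Rightarrow> nat \<Rightarrow> complex) \<Rightarrow> bool" where
  "pos_form n a \<longleftrightarrow> (\<forall>i<n. \<forall>j<n. a i j = cnj (a j i)) \<and> (\<forall>v. 0 \<le> herm_form n a v)"

lemma sum_mult_unit:
  fixes f :: "nat \<Rightarrow> complex"
  assumes "k < n"
  shows "(\<Sum>j<n. f j * (if j = k then t else 0) * c) = f k * t * c"
    "(\<Sum>j<n. f j * (if j = k then t else 0)) = f k * t"
proof -
  have "(\<Sum>j<n. f j * (if j = k then t else 0) * d) = (\<Sum>j<n. if j = k then f k * t * d else 0)" for d
    by (rule sum.cong) auto
  then have *: "(\<Sum>j<n. f j * (if j = k then t else 0) * d) = f k * t * d" for d
    using assms by simp
  show "(\<Sum>j<n. f j * (if j = k then t else 0) * c) = f k * t * c"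
    "(\<Sum>j<n. f j * (if j = k then t else 0)) = f k * t"
    using *[of c] *[of 1] by simp_all
qed

lemma herm_form_add_unit:
  assumes k: "k < n"
  shows "herm_form n a (\<lambda>j. v j + (if j = k then t else 0)) =
    herm_form n a v + t * (\<Sum>i<n. a i k * cnj (v i)) + cnj t * (\<Sum>j<n. a k j * v j) + t * cnj t * a k k"
proof -
  let ?d = "\<lambda>j. if j = k then t else 0"
  have "herm_form n a (\<lambda>j. v j + ?d j) =
     herm_form n a v + (\<Sum>i<n. \<Sum>j<n. a i j * ?d j * cnj (v i))
      + (\<Sum>i<n. \<Sum>j<n. a i j * v j * cnj (?d i)) + (\<Sum>i<n. \<Sum>j<n. a i j * ?d j * cnj (?d i))"
    unfolding herm_form_def sum.distrib[symmetric]
    by (intro sum.cong refl) (simp only: complex_cnj_add ring_distribs ac_simps)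
  also have "(\<Sum>i<n. \<Sum>j<n. a i j * ?d j * cnj (v i)) = (\<Sum>i<n. a i k * t * cnj (v i))"
    using k by (simp only: sum_mult_unit)
  also have "\<dots> = t * (\<Sum>i<n. a i k * cnj (v i))"
    unfolding sum_distrib_left by (intro sum.cong refl) simp
  also have "(\<Sum>i<n. \<Sum>j<n. a i j * v j * cnj (?d i)) = (\<Sum>i<n. if i = k then cnj t * (\<Sum>j<n. a k j * v j) else 0)"
    by (intro sum.cong refl) (auto simp: sum_distrib_left mult_ac)
  also have "\<dots> = cnj t * (\<Sum>j<n. a k j * v j)" using k by simp
  also have "(\<Sum>i<n. \<Sum>j<n. a i j * ?d j * cnj (?d i)) = (\<Sum>i<n. if i = k then a k k * t * cnj t else 0)"
    using k by (intro sum.cong refl) (simp only: sum_mult_unit, simp)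
  also have "\<dots> = t * cnj t * a k k" using k by simp
  finally show ?thesis .
qed

text \<open>
  Evaluating the form at \<open>e\<^sub>l + t * e\<^sub>k\<close> for suitable t reads off everything about a pair of
  entries that is needed below: Hermitian symmetry, vanishing, and the size of \<open>a k l\<close>.
\<close>

lemma herm_form_two_units:
  assumes k: "k < n" and l: "l < n"
  shows "herm_form n a (\<lambda>j. (if j = l then 1 else 0) + (if j = k then t else 0)) =
    a l l + t * a l k + cnj t * a k l + t * cnj t * a k k"
proof -
  let ?e = "\<lambda>j. if j = l then 1 else (0::complex)"
  have "herm_form n a ?e = (\<Sum>i<n. if i = l then a l l else 0)"
    unfolding herm_form_def using l
    by (intro sum.cong refl) (simp only: sum_mult_unit, simp)
  moreover have "(\<Sum>j<n. a k j * ?e j) = a k l"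
    using l by (simp only: sum_mult_unit, simp)
  moreover have "(\<Sum>i<n. a i k * cnj (?e i)) = (\<Sum>i<n. a i k * ?e i)"
    by (intro sum.cong refl) simp
  then have "(\<Sum>i<n. a i k * cnj (?e i)) = a l k"
    using l by (simp only: sum_mult_unit, simp)
  ultimately show ?thesis
    using l by (simp only: herm_form_add_unit[OF k], simp)
qed

text \<open>
  Polarization: t = 1 compares the imaginary parts of \<open>a i j\<close> and \<open>a j i\<close>, and t = \<i> the real parts.
\<close>

lemma herm_if_herm_form_real:
  assumes real: "\<And>v. Im (herm_form n a v) = 0" and i: "i < n" and j: "j < n"
  shows "a i j = cnj (a j i)"
proof -
  have diag: "Im (a k k) = 0" if "k < n" for k
    using real[of "\<lambda>j. (if j = k then 1 else 0) + (if j = k then 0 else 0)"]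
    unfolding herm_form_two_units[OF that that] by simp
  have "Im (a i i + t * a i j + cnj t * a j i + t * cnj t * a j j) = 0" for t
    using real[of "\<lambda>m. (if m = i then 1 else 0) + (if m = j then t else 0)"]
    unfolding herm_form_two_units[OF j i] .
  from this[of 1] this[of \<i>] show ?thesis
    using diag i j by (simp add: complex_eq_iff)
qed

lemma pos_form_herm:
  assumes "pos_form n a" "i < n" "j < n"
  shows "a i j = cnj (a j i)"
  using assms unfolding pos_form_def by blast

lemma pos_form_two_units:
  assumes "pos_form n a" "k < n" "l < n"
  shows "0 \<le> a l l + t * cnj (a k l) + cnj t * a k l + t * cnj t * a k k"
proof -
  have "0 \<le> herm_form n a (\<lambda>j. (if j = l then 1 else 0) + (if j = k then t else 0))"
    using assms(1) unfolding pos_form_def by blast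
  also have "\<dots> = a l l + t * cnj (a k l) + cnj t * a k l + t * cnj t * a k k"
    unfolding herm_form_two_units[OF assms(2,3)] using pos_form_herm[OF assms(1,3,2)] by simp
  finally show ?thesis .
qed

lemma pos_form_diag:
  assumes "pos_form n a" "k < n"
  shows "0 \<le> a k k"
  using pos_form_two_units[OF assms assms(2), of 0] by simp

text \<open>
  If the diagonal entry vanishes, the form at \<open>e\<^sub>l + t * e\<^sub>k\<close> is affine in t, so it could be made
  negative unless its linear coefficient vanishes too.
\<close>

lemma pos_form_zero_diag:
  assumes pos: "pos_form n a" and k: "k < n" and l: "l < n" and z: "a k k = 0"
  shows "a k l = 0"
proof (rule ccontr)
  assume nz: "a k l \<noteq> 0"
  define r where "r = Re (a l l) + 1"
  define c where "c = (cmod (a k l))\<^sup>2"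
  have c: "c > 0" using nz by (simp add: c_def)
  \<comment> \<open>Large enough to outweigh the diagonal entry at l: each cross term becomes -r.\<close>
  define t where "t = - (of_real (r / c) * a k l)"
  have "0 \<le> a l l + t * cnj (a k l) + cnj t * a k l + t * cnj t * a k k"
    using pos_form_two_units[OF pos k l] .
  then have "0 \<le> Re (a l l) + Re (t * cnj (a k l)) + Re (cnj t * a k l)"
    using z by (simp add: less_eq_complex_def)
  also have "t * cnj (a k l) = - of_real r"
    using c unfolding t_def c_def by (simp add: mult.assoc complex_norm_square[symmetric])
  also have "cnj t * a k l = - of_real r"
    using c unfolding t_def c_def
    by (simp add: mult.assoc complex_norm_square[symmetric] mult.commute[of "cnj (a k l)"])
  finally have "Re (a l l) + 2 \<le> 0" by (simp add: r_def)
  moreover have "0 \<le> Re (a l l)" using pos_form_diag[OF pos l] by (simp add: less_eq_complex_def)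
  ultimately show False by simp
qed

lemma pos_form_entry_le:
  assumes pos: "pos_form n a" and k: "k < n" and l: "l < n"
  shows "2 * cmod (a k l) \<le> Re (a k k) + Re (a l l)"
proof -
  \<comment> \<open>This phase makes both cross terms equal to minus the modulus of the entry.\<close>
  define t where "t = - sgn (a k l)"
  have t1: "t * cnj (a k l) = - of_real (cmod (a k l))"
    by (cases "a k l = 0") (auto simp: t_def sgn_eq complex_norm_square[symmetric] power2_eq_square field_simps)
  then have t2: "cnj t * a k l = - of_real (cmod (a k l))"
    by (metis complex_cnj_cnj complex_cnj_complex_of_real complex_cnj_minus complex_cnj_mult)
  have t3: "t * cnj t = of_real ((cmod t)\<^sup>2)" by (rule complex_norm_square[symmetric])
  have "cmod t \<le> 1" by (simp add: t_def norm_sgn)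
  then have t4: "(cmod t)\<^sup>2 \<le> 1" by (simp add: power_le_one)
  have "0 \<le> a l l + t * cnj (a k l) + cnj t * a k l + t * cnj t * a k k"
    using pos_form_two_units[OF pos k l] .
  then have "0 \<le> Re (a l l) - 2 * cmod (a k l) + (cmod t)\<^sup>2 * Re (a k k)"
    unfolding t1 t2 t3 by (simp add: less_eq_complex_def)
  moreover have "0 \<le> Re (a k k)" using pos_form_diag[OF pos k] by (simp add: less_eq_complex_def)
  then have "(cmod t)\<^sup>2 * Re (a k k) \<le> Re (a k k)" using t4 by (simp add: mult_left_le_one_le)
  ultimately show ?thesis by linarith
qed

text \<open>
  One step of Cholesky elimination: subtracting the rank-one form of the k-th column amounts to
  minimising the form over the k-th coordinate (completing the square), and a minimum of
  nonnegative numbers is nonnegative.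
\<close>

lemma pos_form_eliminate:
  assumes pos: "pos_form n a" and k: "k < n" and nz: "a k k \<noteq> 0"
  shows "pos_form n (\<lambda>i j. a i j - a i k * a k j / a k k)"
    (is "pos_form n ?b")
proof -
  have herm: "\<And>i j. i < n \<Longrightarrow> j < n \<Longrightarrow> a i j = cnj (a j i)"
    using pos unfolding pos_form_def by blast
  have real: "cnj (a k k) = a k k" using herm k by metis
  have hb: "?b i j = cnj (?b j i)" if "i < n" "j < n" for i j
    using herm[OF that] herm[OF that(1) k] herm[OF k that(2)] real by simp
  have "0 \<le> herm_form n ?b v" for v
  proof -
    define s where "s = (\<Sum>j<n. a k j * v j)"
    have cs: "cnj s = (\<Sum>i<n. a i k * cnj (v i))"
      unfolding s_def cnj_sum by (intro sum.cong refl) (simp add: herm[OF _ k])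
    have square: "cnj s * s = (\<Sum>i<n. \<Sum>j<n. (a i k * cnj (v i)) * (a k j * v j))"
      unfolding cs unfolding s_def by (rule sum_product)
    define t where "t = - s / a k k"
    have expand: "herm_form n a (\<lambda>j. v j + (if j = k then t else 0)) =
        herm_form n a v + t * cnj s + cnj t * s + t * cnj t * a k k"
      unfolding cs unfolding s_def by (rule herm_form_add_unit[OF k])
    have "herm_form n ?b v = herm_form n a v - cnj s * s / a k k"
      using square unfolding herm_form_def
      by (simp only: sum_divide_distrib flip: sum_subtractf) (simp add: algebra_simps)
    also have "\<dots> = herm_form n a (\<lambda>j. v j + (if j = k then t else 0))"
      unfolding expand using nz real by (simp add: t_def field_simps)
    also have "0 \<le> \<dots>" using pos unfolding pos_form_def by blast
    finally show ?thesis .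
  qed
  with hb show ?thesis unfolding pos_form_def by blast
qed

text \<open>
  The trace of a product of two positive semidefinite matrices is nonnegative. Elimination writes
  a as a sum of rank-one forms, one nonzero diagonal entry at a time, and pairing c with a
  rank-one form is a value of the form of c. This replaces the spectral decomposition.
\<close>

lemma pos_form_pairing_nonneg:
  assumes "pos_form n a" and c: "pos_form n c"
  shows "0 \<le> (\<Sum>i<n. \<Sum>j<n. a i j * c j i)"
  using assms(1)
proof (induction "card {k. k < n \<and> a k k \<noteq> 0}" arbitrary: a rule: less_induct)
  case (less a)
  show ?case
  proof (cases "\<exists>k<n. a k k \<noteq> 0")
    case False
    then have "a i j = 0" if "i < n" "j < n" for i j
      using pos_form_zero_diag[OF less.prems] that by blast
    then show ?thesis by simp
  next
    case True
    then obtain k where k: "k < n" "a k k \<noteq> 0" by blast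
    define b where "b i j = a i j - a i k * a k j / a k k" for i j
    have b: "pos_form n b"
      using pos_form_eliminate[OF less.prems k] unfolding b_def .
    have herm: "\<And>i j. i < n \<Longrightarrow> j < n \<Longrightarrow> a i j = cnj (a j i)"
      using less.prems unfolding pos_form_def by blast
    have "b k k = 0" using k by (simp add: b_def)
    moreover have "b i i = 0" if "i < n" "a i i = 0" for i
      using pos_form_zero_diag[OF less.prems that(1) k(1) that(2)] that(2) by (simp add: b_def)
    ultimately have "{i. i < n \<and> b i i \<noteq> 0} \<subset> {i. i < n \<and> a i i \<noteq> 0}"
      using k by blast
    then have "card {i. i < n \<and> b i i \<noteq> 0} < card {i. i < n \<and> a i i \<noteq> 0}"
      by (intro psubset_card_mono) auto
    then have IH: "0 \<le> (\<Sum>i<n. \<Sum>j<n. b i j * c j i)"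
      using less.hyps b by blast
    have "(\<Sum>i<n. \<Sum>j<n. a i k * a k j / a k k * c j i) = herm_form n c (\<lambda>i. a i k) / a k k"
      unfolding herm_form_def sum_divide_distrib
      by (subst sum.swap) (auto intro!: sum.cong simp: herm[OF _ k(1)])
    moreover have "0 \<le> herm_form n c (\<lambda>i. a i k) / a k k"
      using c pos_form_diag[OF less.prems k(1)] unfolding pos_form_def
      by (auto simp: less_eq_complex_def complex_is_Real_iff Re_divide Im_divide)
    moreover have "(\<Sum>i<n. \<Sum>j<n. a i j * c j i) =
       (\<Sum>i<n. \<Sum>j<n. b i j * c j i) + (\<Sum>i<n. \<Sum>j<n. a i k * a k j / a k k * c j i)"
      unfolding b_def by (simp add: left_diff_distrib flip: sum.distrib)
    ultimately show ?thesis using IH by simp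
  qed
qed

section \<open>Density matrices and the semidefinite order\<close>

lemma mat_adjoint_carrier: "A \<in> carrier_mat n m \<Longrightarrow> mat_adjoint A \<in> carrier_mat m n"
  unfolding mat_adjoint_def by (auto simp: mat_of_rows_def)

lemma mat_adjoint_index:
  assumes "A \<in> carrier_mat n m" "i < m" "j < n"
  shows "mat_adjoint A $$ (i, j) = cnj (A $$ (j, i))"
  using assms unfolding mat_adjoint_def by (auto simp: mat_of_rows_def)

lemma Herm_iff:
  "A \<in> Herm n \<longleftrightarrow> A \<in> carrier_mat n n \<and> (\<forall>i<n. \<forall>j<n. A $$ (i, j) = cnj (A $$ (j, i)))"
proof -
  have "mat_adjoint A = A \<longleftrightarrow> (\<forall>i<n. \<forall>j<n. A $$ (i, j) = cnj (A $$ (j, i)))"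
    if A: "A \<in> carrier_mat n n"
  proof
    assume self: "mat_adjoint A = A"
    show "\<forall>i<n. \<forall>j<n. A $$ (i, j) = cnj (A $$ (j, i))"
      using mat_adjoint_index[OF A, unfolded self] by blast
  next
    assume H: "\<forall>i<n. \<forall>j<n. A $$ (i, j) = cnj (A $$ (j, i))"
    show "mat_adjoint A = A"
    proof (rule eq_matI)
      fix i j assume "i < dim_row A" "j < dim_col A"
      then have ij: "i < n" "j < n" using A by auto
      show "mat_adjoint A $$ (i, j) = A $$ (i, j)"
        unfolding mat_adjoint_index[OF A ij] using H ij by metis
    qed (use A mat_adjoint_carrier[OF A] in auto)
  qed
  then show ?thesis unfolding Herm_def by auto
qed

lemma mat_inner_sum:
  assumes A: "A \<in> carrier_mat n n" and B: "B \<in> carrier_mat n n"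
  shows "mat_inner A B = (\<Sum>i<n. \<Sum>j<n. cnj (A $$ (i, j)) * B $$ (i, j))"
proof -
  have "mat_inner A B = (\<Sum>j<n. \<Sum>i<n. mat_adjoint A $$ (j, i) * B $$ (i, j))"
    unfolding mat_inner_def mat_trace_def using mat_adjoint_carrier[OF A] B
    by (auto simp: scalar_prod_def atLeast0LessThan)
  also have "\<dots> = (\<Sum>j<n. \<Sum>i<n. cnj (A $$ (i, j)) * B $$ (i, j))"
    using mat_adjoint_index[OF A] by simp
  also have "\<dots> = (\<Sum>i<n. \<Sum>j<n. cnj (A $$ (i, j)) * B $$ (i, j))"
    by (rule sum.swap)
  finally show ?thesis .
qed

lemma psd_iff_pos_form:
  assumes A: "A \<in> carrier_mat n n"
  shows "psd A \<longleftrightarrow> pos_form n (\<lambda>i j. A $$ (i, j))"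
proof -
  have *: "(A *\<^sub>v v) \<bullet>c v = herm_form n (\<lambda>i j. A $$ (i, j)) (\<lambda>i. v $ i)" if "v \<in> carrier_vec n" for v
    using A that unfolding herm_form_def
    by (auto simp: scalar_prod_def atLeast0LessThan sum_distrib_right)
  have "(\<forall>v \<in> carrier_vec n. 0 \<le> (A *\<^sub>v v) \<bullet>c v) \<longleftrightarrow> (\<forall>v. 0 \<le> herm_form n (\<lambda>i j. A $$ (i, j)) v)"
  proof safe
    fix v :: "nat \<Rightarrow> complex"
    assume "\<forall>v \<in> carrier_vec n. 0 \<le> (A *\<^sub>v v) \<bullet>c v"
    then have "0 \<le> (A *\<^sub>v vec n v) \<bullet>c vec n v" by simp
    then have "0 \<le> herm_form n (\<lambda>i j. A $$ (i, j)) (\<lambda>i. vec n v $ i)"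
      unfolding *[OF vec_carrier] .
    then show "0 \<le> herm_form n (\<lambda>i j. A $$ (i, j)) v"
      by (simp add: herm_form_def)
  qed (simp add: *)
  then show ?thesis
    using A Herm_iff[of A n] unfolding psd_def pos_form_def carrier_matD(1)[OF A] by blast
qed

lemma psd_ge_iff_pos_form:
  assumes "A \<in> carrier_mat n n" "B \<in> carrier_mat n n"
  shows "A \<succeq> B \<longleftrightarrow> pos_form n (\<lambda>i j. A $$ (i, j) - B $$ (i, j))"
proof -
  have "pos_form n (\<lambda>i j. (A - B) $$ (i, j)) \<longleftrightarrow> pos_form n (\<lambda>i j. A $$ (i, j) - B $$ (i, j))"
    using assms unfolding pos_form_def herm_form_def by auto
  then show ?thesis unfolding psd_ge_def psd_iff_pos_form[OF minus_carrier_mat[OF assms(2)]] by simp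
qed

lemma density_iff:
  "X \<in> density n \<longleftrightarrow>
     X \<in> carrier_mat n n \<and> pos_form n (\<lambda>i j. X $$ (i, j)) \<and> (\<Sum>i<n. X $$ (i, i)) = 1"
proof -
  have "X \<succeq> 0\<^sub>m n n \<longleftrightarrow> pos_form n (\<lambda>i j. X $$ (i, j))" if X: "X \<in> carrier_mat n n"
  proof -
    have "X - 0\<^sub>m n n = X" using X by auto
    then show ?thesis unfolding psd_ge_def using psd_iff_pos_form[OF X] by simp
  qed
  then show ?thesis
    unfolding density_def mat_trace_def by (auto simp: Herm_iff pos_form_def)
qed

lemma density_entry_le_one:
  assumes X: "X \<in> density n" and ij: "i < n" "j < n"
  shows "cmod (X $$ (i, j)) \<le> 1"
proof -
  have pos: "pos_form n (\<lambda>i j. X $$ (i, j))" and tr: "(\<Sum>i<n. X $$ (i, i)) = 1"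
    using X by (auto simp: density_iff)
  have diag: "0 \<le> Re (X $$ (k, k))" if "k < n" for k
    using pos_form_diag[OF pos that] by (simp add: less_eq_complex_def)
  have tr1: "(\<Sum>i<n. Re (X $$ (i, i))) = 1" using tr by (simp flip: Re_sum)
  have le: "Re (X $$ (k, k)) \<le> 1" if "k < n" for k
    using member_le_sum[of k "{..<n}" "\<lambda>i. Re (X $$ (i, i))"] that diag tr1 by auto
  then show ?thesis using pos_form_entry_le[OF pos ij] le[OF ij(1)] le[OF ij(2)] by linarith
qed

lemma sqmat_sum_carrier [simp]: "sqmat_sum n I F \<in> carrier_mat n n"
  by (simp add: sqmat_sum_def)

lemma sqmat_sum_index:
  "i < n \<Longrightarrow> j < n \<Longrightarrow> sqmat_sum n I F $$ (i, j) = (\<Sum>l\<in>I. F l $$ (i, j))"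
  by (simp add: sqmat_sum_def)

lemma density_convex:
  assumes fin: "finite F" and p0: "\<And>z. z \<in> F \<Longrightarrow> (0::real) \<le> p z" and p1: "sum p F = 1"
    and X: "\<And>z. z \<in> F \<Longrightarrow> X z \<in> density n"
  shows "sqmat_sum n F (\<lambda>z. complex_of_real (p z) \<cdot>\<^sub>m X z) \<in> density n"
proof -
  have C: "X z \<in> carrier_mat n n" if "z \<in> F" for z using X[OF that] by (simp add: density_iff)
  define S where "S = sqmat_sum n F (\<lambda>z. complex_of_real (p z) \<cdot>\<^sub>m X z)"
  have SC: "S \<in> carrier_mat n n" by (simp add: S_def)
  have S: "S $$ (i, j) = (\<Sum>z\<in>F. p z * X z $$ (i, j))" if "i < n" "j < n" for i j
  proof -
    have "(complex_of_real (p z) \<cdot>\<^sub>m X z) $$ (i, j) = p z * X z $$ (i, j)" if "z \<in> F" for z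
      using C[OF that] \<open>i < n\<close> \<open>j < n\<close> by auto
    then show ?thesis unfolding S_def sqmat_sum_index[OF that] by simp
  qed
  have "herm_form n (\<lambda>i j. S $$ (i, j)) v = (\<Sum>z\<in>F. p z * herm_form n (\<lambda>i j. X z $$ (i, j)) v)" for v
  proof -
    have "herm_form n (\<lambda>i j. S $$ (i, j)) v = (\<Sum>i<n. \<Sum>j<n. \<Sum>z\<in>F. p z * (X z $$ (i, j) * v j * cnj (v i)))"
      unfolding herm_form_def by (intro sum.cong refl) (simp add: S sum_distrib_right mult.assoc)
    also have "\<dots> = (\<Sum>i<n. \<Sum>z\<in>F. \<Sum>j<n. p z * (X z $$ (i, j) * v j * cnj (v i)))"
      by (intro sum.cong refl sum.swap)
    also have "\<dots> = (\<Sum>z\<in>F. \<Sum>i<n. \<Sum>j<n. p z * (X z $$ (i, j) * v j * cnj (v i)))"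
      by (rule sum.swap)
    finally show ?thesis unfolding herm_form_def by (simp add: sum_distrib_left)
  qed
  moreover have "0 \<le> p z * herm_form n (\<lambda>i j. X z $$ (i, j)) v" if "z \<in> F" for z v
  proof -
    have "0 \<le> complex_of_real (p z)" using p0[OF that] by (simp add: less_eq_complex_def)
    moreover have "0 \<le> herm_form n (\<lambda>i j. X z $$ (i, j)) v"
      using X[OF that] by (simp add: density_iff pos_form_def)
    ultimately show ?thesis by (rule mult_nonneg_nonneg)
  qed
  ultimately have "0 \<le> herm_form n (\<lambda>i j. S $$ (i, j)) v" for v
    by (simp add: sum_nonneg)
  moreover have "S $$ (i, j) = cnj (S $$ (j, i))" if "i < n" "j < n" for i j
  proof -
    have "X z $$ (i, j) = cnj (X z $$ (j, i))" if "z \<in> F" for z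
      using X[OF that] \<open>i < n\<close> \<open>j < n\<close> unfolding density_iff pos_form_def by blast
    then show ?thesis using that by (simp add: S)
  qed
  moreover have "(\<Sum>i<n. S $$ (i, i)) = 1"
  proof -
    have "(\<Sum>i<n. S $$ (i, i)) = (\<Sum>z\<in>F. \<Sum>i<n. p z * X z $$ (i, i))"
      by (subst sum.swap) (simp add: S)
    also have "\<dots> = (\<Sum>z\<in>F. complex_of_real (p z) * (\<Sum>i<n. X z $$ (i, i)))"
      by (simp add: sum_distrib_left)
    also have "\<dots> = (\<Sum>z\<in>F. complex_of_real (p z))"
      using X by (simp add: density_iff)
    finally show ?thesis using p1 by (simp flip: of_real_sum)
  qed
  ultimately show ?thesis
    unfolding S_def[symmetric] density_iff pos_form_def using SC by blast
qed

text \<open>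
  A value of the quadratic form of B at v is, up to normalisation, the inner product of B with the
  pure state along v. This carries statements about density matrices over to quadratic forms.
\<close>

lemma herm_form_eq_inner_pure:
  assumes v: "(\<Sum>i<n. (cmod (v i))\<^sup>2) > 0" and B: "B \<in> carrier_mat n n"
  obtains P where "P \<in> density n"
    "herm_form n (\<lambda>i j. B $$ (i, j)) v = complex_of_real (\<Sum>i<n. (cmod (v i))\<^sup>2) * mat_inner P B"
proof -
  define s where "s = (\<Sum>i<n. (cmod (v i))\<^sup>2)"
  have s: "s > 0" using v by (simp add: s_def)
  define P where "P = mat n n (\<lambda>(i, j). v i * cnj (v j) / complex_of_real s)"
  have PC: "P \<in> carrier_mat n n" by (simp add: P_def)
  have "herm_form n (\<lambda>i j. P $$ (i, j)) u = complex_of_real ((cmod (\<Sum>i<n. v i * cnj (u i)))\<^sup>2 / s)" for u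
  proof -
    have "herm_form n (\<lambda>i j. P $$ (i, j)) u = (\<Sum>i<n. \<Sum>j<n. (v i * cnj (u i)) * cnj (v j * cnj (u j))) / s"
      unfolding herm_form_def sum_divide_distrib
      by (intro sum.cong refl) (simp add: P_def mult_ac)
    also have "\<dots> = (\<Sum>i<n. v i * cnj (u i)) * cnj (\<Sum>i<n. v i * cnj (u i)) / s"
      unfolding cnj_sum by (simp only: sum_product)
    finally show ?thesis by (simp only: of_real_divide complex_norm_square)
  qed
  then have "0 \<le> herm_form n (\<lambda>i j. P $$ (i, j)) u" for u
    using s by (simp add: less_eq_complex_def del: of_real_divide)
  moreover have "(\<Sum>i<n. P $$ (i, i)) = 1"
  proof -
    have "(\<Sum>i<n. P $$ (i, i)) = (\<Sum>i<n. complex_of_real ((cmod (v i))\<^sup>2)) / s"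
      unfolding sum_divide_distrib
      by (intro sum.cong refl) (simp add: P_def complex_norm_square del: of_real_power)
    also have "\<dots> = complex_of_real s / s" by (simp only: s_def of_real_sum)
    finally show ?thesis using s by simp
  qed
  moreover have "P $$ (i, j) = cnj (P $$ (j, i))" if "i < n" "j < n" for i j
    using that by (simp add: P_def mult.commute)
  ultimately have "P \<in> density n"
    using PC unfolding density_iff pos_form_def by blast
  moreover have "herm_form n (\<lambda>i j. B $$ (i, j)) v = s * mat_inner P B"
    unfolding mat_inner_sum[OF PC B] herm_form_def sum_distrib_left
    using s by (intro sum.cong refl) (simp add: P_def)
  ultimately show thesis using that unfolding s_def by blast
qed

lemma density_nonempty:
  assumes "1 \<le> n"
  shows "density n \<noteq> {}"
proof -
  have "0 < (\<Sum>i<n. (cmod 1)\<^sup>2)" using assms by simp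
  from herm_form_eq_inner_pure[OF this zero_carrier_mat] show ?thesis by blast
qed

lemma inner_scalar_minus:
  assumes A: "A \<in> density n" and B: "B \<in> carrier_mat n n"
  shows "(\<Sum>i<n. \<Sum>j<n. A $$ (i, j) * ((w \<cdot>\<^sub>m 1\<^sub>m n) $$ (j, i) - B $$ (j, i))) = w - mat_inner A B"
proof -
  have AC: "A \<in> carrier_mat n n" and H: "\<And>i j. i < n \<Longrightarrow> j < n \<Longrightarrow> A $$ (i, j) = cnj (A $$ (j, i))"
    and tr: "(\<Sum>i<n. A $$ (i, i)) = 1"
    using A unfolding density_iff pos_form_def by blast+
  have "(\<Sum>i<n. \<Sum>j<n. A $$ (i, j) * ((w \<cdot>\<^sub>m 1\<^sub>m n) $$ (j, i) - B $$ (j, i))) =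
    (\<Sum>i<n. \<Sum>j<n. (if j = i then w * A $$ (i, i) else 0)) - (\<Sum>i<n. \<Sum>j<n. A $$ (i, j) * B $$ (j, i))"
    unfolding sum_subtractf[symmetric] by (intro sum.cong refl) (auto simp: algebra_simps)
  also have "(\<Sum>i<n. \<Sum>j<n. (if j = i then w * A $$ (i, i) else 0)) = w * (\<Sum>i<n. A $$ (i, i))"
    by (simp add: sum_distrib_left)
  also have "(\<Sum>i<n. \<Sum>j<n. A $$ (i, j) * B $$ (j, i)) = (\<Sum>j<n. \<Sum>i<n. A $$ (i, j) * B $$ (j, i))"
    by (rule sum.swap)
  also have "\<dots> = mat_inner A B"
    unfolding mat_inner_sum[OF AC B]
  proof (intro sum.cong refl)
    fix j i assume "j \<in> {..<n}" "i \<in> {..<n}"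
    then show "A $$ (i, j) * B $$ (j, i) = cnj (A $$ (j, i)) * B $$ (j, i)"
      using H[of i j] by simp
  qed
  finally show ?thesis using tr by simp
qed

text \<open>
  Together with \<open>scalar_ge_of_inner_le\<close> this says that the semidefinite constraint \<open>w * 1 \<succeq> B\<close> bounds
  the best reply value: it holds exactly when no density matrix has inner product above w with B.
  This direction pairs the two positive semidefinite matrices A and \<open>w * 1 - B\<close>.
\<close>

lemma inner_le_of_scalar_ge:
  assumes A: "A \<in> density n" and B: "B \<in> carrier_mat n n"
    and ge: "complex_of_real w \<cdot>\<^sub>m 1\<^sub>m n \<succeq> B"
  shows "Re (mat_inner A B) \<le> w"
proof -
  have posA: "pos_form n (\<lambda>i j. A $$ (i, j))" using A by (simp add: density_iff)
  have posC: "pos_form n (\<lambda>i j. (complex_of_real w \<cdot>\<^sub>m 1\<^sub>m n) $$ (i, j) - B $$ (i, j))"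
    using ge psd_ge_iff_pos_form[OF _ B, of "complex_of_real w \<cdot>\<^sub>m 1\<^sub>m n"] by simp
  have "0 \<le> complex_of_real w - mat_inner A B"
    using pos_form_pairing_nonneg[OF posA posC] unfolding inner_scalar_minus[OF A B] .
  then show ?thesis by (simp add: less_eq_complex_def)
qed

text \<open>
  Conversely, pure states suffice to test positivity of \<open>w * 1 - B\<close>. That B is Hermitian comes out of
  the reality of the inner products, by polarization.
\<close>

lemma scalar_ge_of_inner_le:
  assumes B: "B \<in> carrier_mat n n"
    and real: "\<And>A. A \<in> density n \<Longrightarrow> Im (mat_inner A B) = 0"
    and le: "\<And>A. A \<in> density n \<Longrightarrow> Re (mat_inner A B) \<le> w"
  shows "complex_of_real w \<cdot>\<^sub>m 1\<^sub>m n \<succeq> B"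
proof -
  define C where "C = complex_of_real w \<cdot>\<^sub>m 1\<^sub>m n - B"
  have C: "C \<in> carrier_mat n n" unfolding C_def by (rule minus_carrier_mat[OF B])
  have nonneg: "0 \<le> herm_form n (\<lambda>i j. C $$ (i, j)) v" for v
  proof (cases "\<forall>i<n. v i = 0")
    case True
    then show ?thesis by (simp add: herm_form_def)
  next
    case False
    then obtain k where k: "k < n" "v k \<noteq> 0" by blast
    have "(cmod (v k))\<^sup>2 \<le> (\<Sum>i<n. (cmod (v i))\<^sup>2)"
      by (rule member_le_sum) (use k in auto)
    moreover have "(cmod (v k))\<^sup>2 > 0" using k by simp
    ultimately have s: "(\<Sum>i<n. (cmod (v i))\<^sup>2) > 0" by linarith
    obtain P where P: "P \<in> density n"
      and eq: "herm_form n (\<lambda>i j. C $$ (i, j)) v = complex_of_real (\<Sum>i<n. (cmod (v i))\<^sup>2) * mat_inner P C"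
      using herm_form_eq_inner_pure[OF s C] by blast
    have PC: "P \<in> carrier_mat n n" and H: "\<And>i j. i < n \<Longrightarrow> j < n \<Longrightarrow> P $$ (i, j) = cnj (P $$ (j, i))"
      using P unfolding density_iff pos_form_def by blast+
    have "mat_inner P C = (\<Sum>i<n. \<Sum>j<n. cnj (P $$ (i, j)) * C $$ (i, j))"
      by (rule mat_inner_sum[OF PC C])
    also have "\<dots> = (\<Sum>j<n. \<Sum>i<n. cnj (P $$ (i, j)) * C $$ (i, j))"
      by (rule sum.swap)
    also have "\<dots> = (\<Sum>j<n. \<Sum>i<n. P $$ (j, i) * ((complex_of_real w \<cdot>\<^sub>m 1\<^sub>m n) $$ (i, j) - B $$ (i, j)))"
    proof (intro sum.cong refl)
      fix j i assume "j \<in> {..<n}" "i \<in> {..<n}"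
      then show "cnj (P $$ (i, j)) * C $$ (i, j) = P $$ (j, i) * ((complex_of_real w \<cdot>\<^sub>m 1\<^sub>m n) $$ (i, j) - B $$ (i, j))"
        using H[of j i] B by (simp add: C_def)
    qed
    also have "\<dots> = complex_of_real w - mat_inner P B"
      by (rule inner_scalar_minus[OF P B])
    finally have "0 \<le> mat_inner P C"
      using real[OF P] le[OF P] by (simp add: less_eq_complex_def)
    moreover have "0 \<le> complex_of_real (\<Sum>i<n. (cmod (v i))\<^sup>2)"
      using s by (simp add: less_eq_complex_def del: of_real_sum of_real_power)
    ultimately show ?thesis unfolding eq by (intro mult_nonneg_nonneg)
  qed
  moreover have "C $$ (i, j) = cnj (C $$ (j, i))" if "i < n" "j < n" for i j
  proof (rule herm_if_herm_form_real[OF _ that])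
    show "Im (herm_form n (\<lambda>i j. C $$ (i, j)) v) = 0" for v
      using nonneg by (simp add: less_eq_complex_def)
  qed
  ultimately show ?thesis
    unfolding psd_ge_def C_def[symmetric] psd_iff_pos_form[OF C] pos_form_def by blast
qed

section \<open>The symmetric game between profiles\<close>

text \<open>
  Total boundedness: cut the cube of possible coordinate vectors into cells of side \<open>\<delta>\<close> and keep one
  point of K in every cell that K meets. The net has to lie inside K, so cell centres would not do.
\<close>

lemma finite_net_of_bounded_coordinates:
  fixes g :: "'a \<Rightarrow> 'c \<Rightarrow> real"
  assumes C: "finite C" and bound: "\<forall>y\<in>K. \<forall>c\<in>C. \<bar>g y c\<bar> \<le> b" and \<delta>: "0 < \<delta>"
  shows "\<exists>F. finite F \<and> F \<subseteq> K \<and> (\<forall>y\<in>K. \<exists>z\<in>F. \<forall>c\<in>C. \<bar>g y c - g z c\<bar> \<le> \<delta>)"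
proof -
  define cell where "cell y = restrict (\<lambda>c. \<lfloor>g y c / \<delta>\<rfloor>) C" for y
  have "\<lfloor>g y c / \<delta>\<rfloor> \<in> {\<lfloor>- b / \<delta>\<rfloor>..\<lfloor>b / \<delta>\<rfloor>}" if "y \<in> K" "c \<in> C" for y c
  proof -
    have "- b / \<delta> \<le> g y c / \<delta>" "g y c / \<delta> \<le> b / \<delta>"
      using bound[rule_format, OF that] \<delta> by (auto intro!: divide_right_mono simp del: divide_minus_left)
    then show ?thesis by (simp add: floor_mono del: divide_minus_left)
  qed
  then have "cell ` K \<subseteq> (\<Pi>\<^sub>E c\<in>C. {\<lfloor>- b / \<delta>\<rfloor>..\<lfloor>b / \<delta>\<rfloor>})"
    unfolding cell_def by auto
  then have fin: "finite (cell ` K)"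
    using C by (meson finite_PiE finite_atLeastAtMost_int finite_subset)
  define F where "F = inv_into K cell ` cell ` K"
  have "F \<subseteq> K" unfolding F_def by (auto intro: inv_into_into)
  moreover have "\<exists>z\<in>F. \<forall>c\<in>C. \<bar>g y c - g z c\<bar> \<le> \<delta>" if y: "y \<in> K" for y
  proof
    let ?z = "inv_into K cell (cell y)"
    show "?z \<in> F" using y by (simp add: F_def)
    have same: "cell ?z = cell y" using y by (simp add: f_inv_into_f)
    show "\<forall>c\<in>C. \<bar>g y c - g ?z c\<bar> \<le> \<delta>"
    proof
      fix c assume "c \<in> C"
      then have "\<lfloor>g ?z c / \<delta>\<rfloor> = \<lfloor>g y c / \<delta>\<rfloor>"
        using fun_cong[OF same, of c] by (simp add: cell_def)
      then have "\<bar>g y c / \<delta> - g ?z c / \<delta>\<bar> \<le> 1" by linarith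
      then show "\<bar>g y c - g ?z c\<bar> \<le> \<delta>"
        using \<delta> by (simp add: abs_le_iff field_simps)
    qed
  qed
  moreover have "finite F" unfolding F_def using fin by simp
  ultimately show ?thesis by blast
qed

locale sdp_game =
  fixes \<Gamma> :: sdp_network_game
  assumes game: "semidefinite_network_game \<Gamma>"
begin

abbreviation "d \<equiv> strat_dim \<Gamma>"
abbreviation "P \<equiv> players \<Gamma>"
abbreviation "N \<equiv> neighbors \<Gamma>"

lemma finite_players [simp]: "finite P"
  by (simp add: players_def)

lemma neighborD:
  assumes "j \<in> N i"
  shows "(i, j) \<in> parcs (game_graph \<Gamma>)" "i \<in> P" "j \<in> P" "i \<noteq> j"
proof -
  interpret pair_graph "game_graph \<Gamma>"
    using game by (simp add: semidefinite_network_game_def)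
  show arc: "(i, j) \<in> parcs (game_graph \<Gamma>)"
    using assms by (simp add: neighbors_def)
  show "i \<in> P" "j \<in> P"
    using in_arcsD1[OF arc] in_arcsD2[OF arc] game
    by (auto simp: semidefinite_network_game_def)
  show "i \<noteq> j" using no_loops[OF arc] by simp
qed

lemma payoff_mat_carrier:
  "j \<in> N i \<Longrightarrow> payoff_mat \<Gamma> i j \<in> carrier_mat (d i * d j) (d i * d j)"
  using game neighborD(1) unfolding semidefinite_network_game_def Herm_def by blast

text \<open>
  An index r of the tensor product splits into the index for player i and the one for player j;
  which of the two comes first depends on the order of the two players.
\<close>

definition own_index :: "nat \<Rightarrow> nat \<Rightarrow> nat \<Rightarrow> nat" where
  "own_index i j r = (if i < j then r div d j else r mod d i)"

definition other_index :: "nat \<Rightarrow> nat \<Rightarrow> nat \<Rightarrow> nat" where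
  "other_index i j r = (if i < j then r mod d j else r div d i)"

lemma index_less:
  assumes "r < d i * d j"
  shows "own_index i j r < d i" "other_index i j r < d j"
proof -
  have "0 < d i" "0 < d j" using assms by (auto intro: ccontr)
  then show "own_index i j r < d i" "other_index i j r < d j"
    using assms unfolding own_index_def other_index_def
    by (auto simp: less_mult_imp_div_less mult.commute)
qed

text \<open>
  The payoff on an edge as an explicit bilinear form in the entries of the two strategies, uniformly
  in the order of the players. Bilinearity and continuity of the game are both read off from it.
\<close>

lemma edge_payoff_entries:
  assumes j: "j \<in> N i" and A: "A \<in> carrier_mat (d i) (d i)" and B: "B \<in> carrier_mat (d j) (d j)"
  shows "edge_payoff \<Gamma> i j A B =
    (\<Sum>r<d i * d j. \<Sum>c<d i * d j. Re (cnj (payoff_mat \<Gamma> i j $$ (r, c)) *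
       A $$ (own_index i j r, own_index i j c) * B $$ (other_index i j r, other_index i j c)))"
proof -
  let ?T = "if i < j then A \<otimes>\<^sub>m B else B \<otimes>\<^sub>m A"
  have T: "?T \<in> carrier_mat (d i * d j) (d i * d j)"
    using A B unfolding tensor_def by (auto simp: mult.commute)
  have entry: "?T $$ (r, c) = A $$ (own_index i j r, own_index i j c) * B $$ (other_index i j r, other_index i j c)"
    if "r < d i * d j" "c < d i * d j" for r c
    using that A B unfolding tensor_def own_index_def other_index_def
    by (auto simp: mult.commute)
  show ?thesis
    unfolding edge_payoff_def mat_inner_sum[OF payoff_mat_carrier[OF j] T] Re_sum
    by (intro sum.cong refl) (simp add: entry mult.assoc del: times_complex.sel)
qed

lemma edge_payoff_diff_le:
  assumes j: "j \<in> N i"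
    and A: "A \<in> carrier_mat (d i) (d i)" and A': "A' \<in> carrier_mat (d i) (d i)"
    and B: "B \<in> density (d j)"
    and close: "\<forall>a<d i. \<forall>b<d i. cmod (A $$ (a, b) - A' $$ (a, b)) \<le> \<delta>"
  shows "edge_payoff \<Gamma> i j A B - edge_payoff \<Gamma> i j A' B \<le>
    (\<Sum>r<d i * d j. \<Sum>c<d i * d j. cmod (payoff_mat \<Gamma> i j $$ (r, c))) * \<delta>"
proof -
  have BC: "B \<in> carrier_mat (d j) (d j)" using B by (simp add: density_iff)
  let ?R = "payoff_mat \<Gamma> i j"
  have "Re (cnj (?R $$ (r, c)) * A $$ (own_index i j r, own_index i j c) * B $$ (other_index i j r, other_index i j c)) -
        Re (cnj (?R $$ (r, c)) * A' $$ (own_index i j r, own_index i j c) * B $$ (other_index i j r, other_index i j c))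
        \<le> cmod (?R $$ (r, c)) * \<delta>" (is "Re (?k * ?x * ?y) - Re (?k * ?x' * ?y) \<le> _")
    if rc: "r < d i * d j" "c < d i * d j" for r c
  proof -
    have "Re (?k * ?x * ?y) - Re (?k * ?x' * ?y) = Re (?k * ((?x - ?x') * ?y))"
      by (simp add: algebra_simps)
    also have "\<dots> \<le> cmod (?k * ((?x - ?x') * ?y))" by (rule complex_Re_le_cmod)
    also have "\<dots> = cmod (?R $$ (r, c)) * (cmod (?x - ?x') * cmod ?y)" by (simp add: norm_mult)
    also have "\<dots> \<le> cmod (?R $$ (r, c)) * (\<delta> * 1)"
    proof (intro mult_left_mono mult_mono)
      show "cmod (?x - ?x') \<le> \<delta>" using close index_less rc by blast
      then show "0 \<le> \<delta>" using norm_ge_zero order_trans by blast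
      show "cmod ?y \<le> 1" using density_entry_le_one[OF B] index_less rc by blast
    qed auto
    finally show ?thesis by simp
  qed
  then show ?thesis
    unfolding edge_payoff_entries[OF j A BC] edge_payoff_entries[OF j A' BC]
      sum_subtractf[symmetric] sum_distrib_right
    by (intro sum_mono) auto
qed

definition mix :: "((nat \<Rightarrow> complex mat) \<Rightarrow> real) \<Rightarrow> (nat \<Rightarrow> complex mat) set \<Rightarrow> nat \<Rightarrow> complex mat" where
  "mix p F = (\<lambda>i\<in>P. sqmat_sum (d i) F (\<lambda>z. complex_of_real (p z) \<cdot>\<^sub>m z i))"

lemma profile_density: "X \<in> profiles \<Gamma> \<Longrightarrow> i \<in> P \<Longrightarrow> X i \<in> density (d i)"
  by (auto simp: profiles_def strategies_def)

lemma profile_carrier: "X \<in> profiles \<Gamma> \<Longrightarrow> i \<in> P \<Longrightarrow> X i \<in> carrier_mat (d i) (d i)"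
  using profile_density by (simp add: density_iff)

lemma mix_profile:
  assumes "finite F" "F \<subseteq> profiles \<Gamma>" "\<And>z. z \<in> F \<Longrightarrow> 0 \<le> p z" "sum p F = 1"
  shows "mix p F \<in> profiles \<Gamma>"
  using assms unfolding profiles_def mix_def strategies_def
  by (auto intro!: density_convex)

lemma mix_entry:
  assumes "F \<subseteq> profiles \<Gamma>" "i \<in> P" "a < d i" "b < d i"
  shows "mix p F i $$ (a, b) = (\<Sum>z\<in>F. complex_of_real (p z) * z i $$ (a, b))"
proof -
  have "(complex_of_real (p z) \<cdot>\<^sub>m z i) $$ (a, b) = complex_of_real (p z) * z i $$ (a, b)" if "z \<in> F" for z
    using profile_carrier[of z i] assms that by auto
  then show ?thesis using assms by (simp add: mix_def sqmat_sum_index)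
qed

text \<open>
  The total payoff when every player i deviates to \<open>Y i\<close> against opponents who follow X. As a
  function of two whole profiles it turns the network game into a two-player game.
\<close>

definition cross_payoff :: "(nat \<Rightarrow> complex mat) \<Rightarrow> (nat \<Rightarrow> complex mat) \<Rightarrow> real" where
  "cross_payoff Y X = (\<Sum>i\<in>P. \<Sum>j\<in>N i. edge_payoff \<Gamma> i j (Y i) (X j))"

lemma mix_carrier: "i \<in> P \<Longrightarrow> mix p F i \<in> carrier_mat (d i) (d i)"
  by (simp add: mix_def)

lemma edge_payoff_mix:
  assumes F: "F \<subseteq> profiles \<Gamma>" and H: "H \<subseteq> profiles \<Gamma>" and j: "j \<in> N i"
  shows "edge_payoff \<Gamma> i j (mix p F i) (mix q H j) =
    (\<Sum>y\<in>F. \<Sum>x\<in>H. p y * q x * edge_payoff \<Gamma> i j (y i) (x j))"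
proof -
  note ij = neighborD[OF j]
  let ?n = "d i * d j"
  let ?f = "\<lambda>y x r c. Re (cnj (payoff_mat \<Gamma> i j $$ (r, c)) *
     y i $$ (own_index i j r, own_index i j c) * x j $$ (other_index i j r, other_index i j c))"
  have entry: "?f (mix p F) (mix q H) r c = (\<Sum>y\<in>F. \<Sum>x\<in>H. p y * q x * ?f y x r c)"
    if rc: "r < ?n" "c < ?n" for r c
  proof -
    let ?k = "cnj (payoff_mat \<Gamma> i j $$ (r, c))"
    let ?a = "\<lambda>y. y i $$ (own_index i j r, own_index i j c)"
    let ?b = "\<lambda>x. x j $$ (other_index i j r, other_index i j c)"
    have "?k * ?a (mix p F) * ?b (mix q H) =
        (\<Sum>y\<in>F. ?k * (complex_of_real (p y) * ?a y)) * (\<Sum>x\<in>H. complex_of_real (q x) * ?b x)"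
      using rc index_less mix_entry[OF F ij(2)] mix_entry[OF H ij(3)]
      by (simp add: sum_distrib_left)
    also have "\<dots> = (\<Sum>y\<in>F. \<Sum>x\<in>H. complex_of_real (p y * q x) * (?k * ?a y * ?b x))"
      unfolding sum_product by (intro sum.cong refl) simp
    finally have "?k * ?a (mix p F) * ?b (mix q H) =
        (\<Sum>y\<in>F. \<Sum>x\<in>H. complex_of_real (p y * q x) * (?k * ?a y * ?b x))" .
    moreover have "Re (complex_of_real a * z) = a * Re z" for a z by simp
    ultimately show ?thesis by (simp only: Re_sum)
  qed
  have "edge_payoff \<Gamma> i j (mix p F i) (mix q H j) =
      (\<Sum>r<?n. \<Sum>c<?n. \<Sum>y\<in>F. \<Sum>x\<in>H. p y * q x * ?f y x r c)"
    unfolding edge_payoff_entries[OF j mix_carrier[OF ij(2)] mix_carrier[OF ij(3)]]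
    by (intro sum.cong refl) (rule entry, auto)
  also have "\<dots> = (\<Sum>y\<in>F. \<Sum>r<?n. \<Sum>c<?n. \<Sum>x\<in>H. p y * q x * ?f y x r c)"
    by (simp only: sum.swap[of _ _ F])
  also have "\<dots> = (\<Sum>y\<in>F. \<Sum>x\<in>H. \<Sum>r<?n. \<Sum>c<?n. p y * q x * ?f y x r c)"
    by (intro sum.cong refl) (simp only: sum.swap[of _ _ H])
  also have "\<dots> = (\<Sum>y\<in>F. \<Sum>x\<in>H. p y * q x * edge_payoff \<Gamma> i j (y i) (x j))"
  proof (intro sum.cong refl)
    fix y x assume "y \<in> F" "x \<in> H"
    then have y: "y i \<in> carrier_mat (d i) (d i)" and x: "x j \<in> carrier_mat (d j) (d j)"
      using F H ij profile_carrier by blast+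
    show "(\<Sum>r<?n. \<Sum>c<?n. p y * q x * ?f y x r c) = p y * q x * edge_payoff \<Gamma> i j (y i) (x j)"
      unfolding edge_payoff_entries[OF j y x] sum_distrib_left ..
  qed
  finally show ?thesis .
qed

lemma cross_payoff_mix:
  assumes F: "F \<subseteq> profiles \<Gamma>" and H: "H \<subseteq> profiles \<Gamma>"
  shows "cross_payoff (mix p F) (mix q H) = (\<Sum>y\<in>F. \<Sum>x\<in>H. p y * q x * cross_payoff y x)"
proof -
  have "cross_payoff (mix p F) (mix q H) =
      (\<Sum>i\<in>P. \<Sum>j\<in>N i. \<Sum>y\<in>F. \<Sum>x\<in>H. p y * q x * edge_payoff \<Gamma> i j (y i) (x j))"
    unfolding cross_payoff_def by (intro sum.cong refl edge_payoff_mix[OF F H])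
  also have "\<dots> = (\<Sum>y\<in>F. \<Sum>i\<in>P. \<Sum>j\<in>N i. \<Sum>x\<in>H. p y * q x * edge_payoff \<Gamma> i j (y i) (x j))"
    by (simp only: sum.swap[of _ _ F])
  also have "\<dots> = (\<Sum>y\<in>F. \<Sum>x\<in>H. \<Sum>i\<in>P. \<Sum>j\<in>N i. p y * q x * edge_payoff \<Gamma> i j (y i) (x j))"
    by (intro sum.cong refl) (simp only: sum.swap[of _ _ H])
  finally show ?thesis by (simp only: cross_payoff_def sum_distrib_left)
qed

lemma mix_singleton:
  assumes "X \<in> profiles \<Gamma>"
  shows "mix (\<lambda>_. 1) {X} = X"
proof
  fix i
  show "mix (\<lambda>_. 1) {X} i = X i"
  proof (cases "i \<in> P")
    case True
    with assms show ?thesis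
      using mix_carrier[OF True] profile_carrier[OF assms True] by (intro eq_matI) (auto simp: mix_entry)
  next
    case False
    then have "X i = undefined" using assms unfolding profiles_def by (rule PiE_arb[rotated])
    then show ?thesis using False by (simp add: mix_def)
  qed
qed

lemma cross_payoff_diff_le:
  assumes Y: "Y \<in> profiles \<Gamma>" and Z: "Z \<in> profiles \<Gamma>" and X: "X \<in> profiles \<Gamma>"
    and close: "\<forall>i\<in>P. \<forall>a<d i. \<forall>b<d i. cmod (Y i $$ (a, b) - Z i $$ (a, b)) \<le> \<delta>"
  shows "cross_payoff Y X \<le> cross_payoff Z X +
    (\<Sum>i\<in>P. \<Sum>j\<in>N i. \<Sum>r<d i * d j. \<Sum>c<d i * d j. cmod (payoff_mat \<Gamma> i j $$ (r, c))) * \<delta>"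
proof -
  have "cross_payoff Y X - cross_payoff Z X =
     (\<Sum>i\<in>P. \<Sum>j\<in>N i. edge_payoff \<Gamma> i j (Y i) (X j) - edge_payoff \<Gamma> i j (Z i) (X j))"
    by (simp add: cross_payoff_def sum_subtractf)
  also have "\<dots> \<le> (\<Sum>i\<in>P. \<Sum>j\<in>N i. (\<Sum>r<d i * d j. \<Sum>c<d i * d j. cmod (payoff_mat \<Gamma> i j $$ (r, c))) * \<delta>)"
  proof (intro sum_mono)
    fix i j assume i: "i \<in> P" and j: "j \<in> N i"
    show "edge_payoff \<Gamma> i j (Y i) (X j) - edge_payoff \<Gamma> i j (Z i) (X j) \<le>
        (\<Sum>r<d i * d j. \<Sum>c<d i * d j. cmod (payoff_mat \<Gamma> i j $$ (r, c))) * \<delta>"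
      using close i
      by (intro edge_payoff_diff_le[OF j profile_carrier[OF Y i] profile_carrier[OF Z i]
            profile_density[OF X neighborD(3)[OF j]]]) blast
  qed
  finally show ?thesis by (simp add: sum_distrib_right)
qed

lemma profiles_finite_net:
  assumes \<delta>: "0 < \<delta>"
  shows "\<exists>F. finite F \<and> F \<subseteq> profiles \<Gamma> \<and> (\<forall>Y\<in>profiles \<Gamma>.
    \<exists>Z\<in>F. \<forall>i\<in>P. \<forall>a<d i. \<forall>b<d i. cmod (Y i $$ (a, b) - Z i $$ (a, b)) \<le> \<delta>)"
proof -
  define C where "C = (SIGMA i:P. {..<d i} \<times> {..<d i}) \<times> (UNIV :: bool set)"
  define g where "g Y = (\<lambda>((i, ab), re). if re then Re (Y i $$ ab) else Im (Y i $$ ab))" for Y :: "nat \<Rightarrow> complex mat"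
  have C: "finite C" by (simp add: C_def)
  have g: "\<forall>Y\<in>profiles \<Gamma>. \<forall>c\<in>C. \<bar>g Y c\<bar> \<le> 1"
  proof (intro ballI)
    fix Y c assume Y: "Y \<in> profiles \<Gamma>" and cC: "c \<in> C"
    obtain i a b re where c: "c = ((i, (a, b)), re)" "i \<in> P" "a < d i" "b < d i"
      using cC by (auto simp: C_def)
    have "cmod (Y i $$ (a, b)) \<le> 1"
      using density_entry_le_one[OF profile_density[OF Y c(2)] c(3,4)] .
    then show "\<bar>g Y c\<bar> \<le> 1"
      using abs_Re_le_cmod[of "Y i $$ (a, b)"] abs_Im_le_cmod[of "Y i $$ (a, b)"] by (simp add: g_def c(1))
  qed
  have half: "0 < \<delta> / 2" using \<delta> by simp
  obtain F where F: "finite F" "F \<subseteq> profiles \<Gamma>"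
    and net: "\<forall>Y\<in>profiles \<Gamma>. \<exists>Z\<in>F. \<forall>c\<in>C. \<bar>g Y c - g Z c\<bar> \<le> \<delta> / 2"
    using finite_net_of_bounded_coordinates[OF C g half] by blast
  have "\<exists>Z\<in>F. \<forall>i\<in>P. \<forall>a<d i. \<forall>b<d i. cmod (Y i $$ (a, b) - Z i $$ (a, b)) \<le> \<delta>"
    if Y: "Y \<in> profiles \<Gamma>" for Y
  proof -
    obtain Z where Z: "Z \<in> F" "\<forall>c\<in>C. \<bar>g Y c - g Z c\<bar> \<le> \<delta> / 2" using net Y by blast
    have "cmod (Y i $$ (a, b) - Z i $$ (a, b)) \<le> \<delta>" if "i \<in> P" "a < d i" "b < d i" for i a b
    proof -
      have "((i, (a, b)), True) \<in> C" "((i, (a, b)), False) \<in> C" using that by (auto simp: C_def)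
      then have "\<bar>Re (Y i $$ (a, b) - Z i $$ (a, b))\<bar> \<le> \<delta> / 2" "\<bar>Im (Y i $$ (a, b) - Z i $$ (a, b))\<bar> \<le> \<delta> / 2"
        using Z(2) by (force simp: g_def)+
      then show ?thesis using cmod_le[of "Y i $$ (a, b) - Z i $$ (a, b)"] by linarith
    qed
    then show ?thesis using Z(1) by blast
  qed
  then show ?thesis using F by blast
qed

end

locale zero_sum_sdp_game = sdp_game +
  assumes zero_sum: "zero_sum \<Gamma>"
begin

lemma cross_payoff_self:
  "X \<in> profiles \<Gamma> \<Longrightarrow> cross_payoff X X = 0"
  using zero_sum by (simp add: zero_sum_def cross_payoff_def payoff_def)

text \<open>
  The game between two profiles is symmetric: \<open>cross_payoff\<close> is bilinear and vanishes on the diagonal,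
  so expanding it at the midpoint of X and Y leaves only the two mixed terms.
\<close>

lemma cross_payoff_skew:
  assumes Y: "Y \<in> profiles \<Gamma>" and X: "X \<in> profiles \<Gamma>"
  shows "cross_payoff Y X = - cross_payoff X Y"
proof (cases "X = Y")
  case True
  then show ?thesis using cross_payoff_self[OF X] by simp
next
  case False
  let ?M = "mix (\<lambda>_. 1 / 2) {X, Y}"
  have "?M \<in> profiles \<Gamma>" using X Y False by (intro mix_profile) auto
  then have "0 = cross_payoff ?M ?M" by (simp add: cross_payoff_self)
  also have "\<dots> = (1 / 4) * (cross_payoff Y X + cross_payoff X Y)"
    using cross_payoff_mix[of "{X, Y}" "{X, Y}" "\<lambda>_. 1 / 2" "\<lambda>_. 1 / 2"] X Y False
    by (simp add: cross_payoff_self)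
  finally show ?thesis by simp
qed

lemma profiles_nonempty: "profiles \<Gamma> \<noteq> {}"
  using game unfolding profiles_def strategies_def semidefinite_network_game_def PiE_eq_empty_iff
  by (simp add: density_nonempty)

text \<open>
  The minimax theorem for the symmetric game on the infinite set of profiles. A fine net F turns it
  into a finite skew game, whose approximate equilibrium p is averaged to a single profile by
  bilinearity. Any profile Y is close to a member of F, which controls the payoff of Y.
\<close>

lemma near_optimal_profile:
  assumes \<epsilon>: "0 < \<epsilon>"
  shows "\<exists>X\<in>profiles \<Gamma>. \<forall>Y\<in>profiles \<Gamma>. cross_payoff Y X \<le> \<epsilon>"
proof -
  define L where "L = (\<Sum>i\<in>P. \<Sum>j\<in>N i. \<Sum>r<d i * d j. \<Sum>c<d i * d j. cmod (payoff_mat \<Gamma> i j $$ (r, c)))"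
  have L: "0 \<le> L" unfolding L_def by (intro sum_nonneg) auto
  \<comment> \<open>L is a Lipschitz constant of the payoff in the first profile; half of \<open>\<epsilon>\<close> is left for the finite game.\<close>
  define \<delta> where "\<delta> = \<epsilon> / (2 * (L + 1))"
  have \<delta>: "0 < \<delta>" using L \<epsilon> by (simp add: \<delta>_def)
  have "L * \<delta> \<le> (L + 1) * \<delta>" using \<delta> by simp
  also have "\<dots> = \<epsilon> / 2" using L by (simp add: \<delta>_def divide_simps)
  finally have L\<delta>: "L * \<delta> \<le> \<epsilon> / 2" .
  obtain F where F: "finite F" "F \<subseteq> profiles \<Gamma>"
    and net: "\<forall>Y\<in>profiles \<Gamma>.
      \<exists>Z\<in>F. \<forall>i\<in>P. \<forall>a<d i. \<forall>b<d i. cmod (Y i $$ (a, b) - Z i $$ (a, b)) \<le> \<delta>"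
    using profiles_finite_net[OF \<delta>] by blast
  have ne: "F \<noteq> {}" using net profiles_nonempty by blast
  have skew: "\<forall>k\<in>F. \<forall>l\<in>F. cross_payoff k l = - cross_payoff l k"
    using cross_payoff_skew F(2) by blast
  have "0 < \<epsilon> / 2" using \<epsilon> by simp
  from skew_game_near_equilibrium[OF F(1) ne skew this]
  obtain p where p: "\<forall>k\<in>F. 0 \<le> p k" "sum p F = 1"
    and eq: "\<forall>k\<in>F. (\<Sum>l\<in>F. cross_payoff k l * p l) \<le> \<epsilon> / 2"
    by blast
  have X: "mix p F \<in> profiles \<Gamma>" using mix_profile F p by blast
  have "cross_payoff Y (mix p F) \<le> \<epsilon>" if Y: "Y \<in> profiles \<Gamma>" for Y
  proof -
    obtain Z where Z: "Z \<in> F"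
      and close: "\<forall>i\<in>P. \<forall>a<d i. \<forall>b<d i. cmod (Y i $$ (a, b) - Z i $$ (a, b)) \<le> \<delta>"
      using net Y by blast
    have Zp: "Z \<in> profiles \<Gamma>" using Z F(2) by blast
    have "cross_payoff Z (mix p F) = cross_payoff (mix (\<lambda>_. 1) {Z}) (mix p F)"
      by (simp only: mix_singleton[OF Zp])
    also have "\<dots> = (\<Sum>l\<in>F. cross_payoff Z l * p l)"
      using cross_payoff_mix[of "{Z}" F] F(2) Zp by (simp add: mult.commute)
    finally have "cross_payoff Z (mix p F) \<le> \<epsilon> / 2" using eq Z by simp
    moreover have "cross_payoff Y (mix p F) \<le> cross_payoff Z (mix p F) + L * \<delta>"
      unfolding L_def by (rule cross_payoff_diff_le[OF Y Zp X close])
    ultimately show ?thesis using L\<delta> by linarith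
  qed
  then show ?thesis using X by blast
qed

end

section \<open>Equilibria and the semidefinite program\<close>

context zero_sum_sdp_game begin

text \<open>
  From profiles to the variables w of the program: w i is the value of a best reply of player i. The
  total deviation payoff splits over the players, so best replies found separately can be combined
  into one deviating profile, to which the bound of \<open>near_optimal_profile\<close> applies.
\<close>

lemma near_optimal_bounds:
  assumes \<epsilon>: "0 < \<epsilon>"
  shows "\<exists>X\<in>profiles \<Gamma>. \<exists>w. (\<forall>i\<in>P. \<forall>A\<in>strategies \<Gamma> i. (\<Sum>j\<in>N i. edge_payoff \<Gamma> i j A (X j)) \<le> w i) \<and> sum w P \<le> \<epsilon>"
proof -
  have "0 < \<epsilon> / 2" using \<epsilon> by simp
  from near_optimal_profile[OF this] obtain X where X: "X \<in> profiles \<Gamma>"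
    and le: "\<forall>Y\<in>profiles \<Gamma>. cross_payoff Y X \<le> \<epsilon> / 2"
    by blast
  define h where "h i A = (\<Sum>j\<in>N i. edge_payoff \<Gamma> i j A (X j))" for i A
  have h_sum: "cross_payoff Y X = (\<Sum>i\<in>P. h i (Y i))" for Y
    by (simp add: cross_payoff_def h_def)
  have XS: "X i \<in> strategies \<Gamma> i" if "i \<in> P" for i using X that by (auto simp: profiles_def)
  have bdd: "bdd_above (h i ` strategies \<Gamma> i)" if i: "i \<in> P" for i
  proof -
    have "h i A \<le> \<epsilon> / 2 - (\<Sum>k\<in>P - {i}. h k (X k))" if A: "A \<in> strategies \<Gamma> i" for A
    proof -
      have "X(i := A) \<in> profiles \<Gamma>"
        using X A i unfolding profiles_def by (auto simp: PiE_iff extensional_def)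
      then have "(\<Sum>k\<in>P. h k ((X(i := A)) k)) \<le> \<epsilon> / 2" using le h_sum by metis
      also have "(\<Sum>k\<in>P. h k ((X(i := A)) k)) = h i A + (\<Sum>k\<in>P - {i}. h k (X k))"
        using i by (simp add: sum.remove)
      finally show ?thesis by simp
    qed
    then show ?thesis by (auto simp: bdd_above_def)
  qed
  define s where "s i = (SUP A\<in>strategies \<Gamma> i. h i A)" for i
  \<comment> \<open>Suprema are attained only up to \<open>\<eta>\<close>; all players together lose at most half of \<open>\<epsilon>\<close>.\<close>
  define \<eta> where "\<eta> = \<epsilon> / (2 * (real (card P) + 1))"
  have \<eta>: "0 < \<eta>" using \<epsilon> by (simp add: \<eta>_def)
  have near: "\<exists>A\<in>strategies \<Gamma> i. s i - \<eta> < h i A" if i: "i \<in> P" for i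
  proof (rule ccontr)
    assume "\<not> ?thesis"
    then have "s i \<le> s i - \<eta>"
      unfolding s_def using XS[OF i] by (intro cSUP_least) (auto simp: not_less)
    then show False using \<eta> by simp
  qed
  then obtain Y0 where Y0: "\<forall>i\<in>P. Y0 i \<in> strategies \<Gamma> i \<and> s i - \<eta> < h i (Y0 i)" by metis
  define Y where "Y = restrict Y0 P"
  have "Y \<in> profiles \<Gamma>" using Y0 by (auto simp: Y_def profiles_def)
  then have "(\<Sum>i\<in>P. h i (Y i)) \<le> \<epsilon> / 2" using le h_sum by metis
  moreover have "(\<Sum>i\<in>P. s i) \<le> (\<Sum>i\<in>P. h i (Y i) + \<eta>)"
  proof (rule sum_mono)
    fix i assume "i \<in> P"
    then have "s i - \<eta> < h i (Y0 i)" using Y0 by blast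
    then show "s i \<le> h i (Y i) + \<eta>" using \<open>i \<in> P\<close> by (simp add: Y_def)
  qed
  moreover have "real (card P) * \<eta> \<le> \<epsilon> / 2"
    using \<epsilon> by (simp add: \<eta>_def divide_simps)
  ultimately have "sum s P \<le> \<epsilon>" by (simp add: sum.distrib)
  moreover have "h i A \<le> s i" if "i \<in> P" "A \<in> strategies \<Gamma> i" for i A
    unfolding s_def using bdd[OF that(1)] that(2) by (intro cSUP_upper)
  ultimately show ?thesis using X unfolding h_def by blast
qed

end

locale sdp_game_operators = zero_sum_sdp_game +
  fixes \<Phi> :: "nat \<Rightarrow> nat \<Rightarrow> complex mat \<Rightarrow> complex mat"
  assumes ops: "payoff_operators \<Gamma> \<Phi>"
begin

lemma operator_linear: "j \<in> N i \<Longrightarrow> op_linear (d j) (d i) (\<Phi> i j)"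
  using ops neighborD(1) unfolding payoff_operators_def by blast

lemma operator_inner:
  assumes j: "j \<in> N i" and A: "A \<in> strategies \<Gamma> i" and B: "B \<in> strategies \<Gamma> j"
  shows "mat_inner A (\<Phi> i j B) = complex_of_real (edge_payoff \<Gamma> i j A B)"
proof -
  have "\<forall>A \<in> strategies \<Gamma> i. \<forall>B \<in> strategies \<Gamma> j.
      complex_of_real (edge_payoff \<Gamma> i j A B) = mat_inner A (\<Phi> i j B)"
    using ops neighborD(1)[OF j] unfolding payoff_operators_def by blast
  then show ?thesis using A B by metis
qed

lemma total_operator_carrier [simp]: "total_operator \<Gamma> \<Phi> i X \<in> carrier_mat (d i) (d i)"
  by (simp add: total_operator_def)

lemma mat_inner_sqmat_sum:
  assumes A: "A \<in> carrier_mat n n" and F: "\<forall>l\<in>I. F l \<in> carrier_mat n n"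
  shows "mat_inner A (sqmat_sum n I F) = (\<Sum>l\<in>I. mat_inner A (F l))"
proof -
  have "mat_inner A (sqmat_sum n I F) = (\<Sum>i<n. \<Sum>j<n. \<Sum>l\<in>I. cnj (A $$ (i, j)) * F l $$ (i, j))"
    unfolding mat_inner_sum[OF A sqmat_sum_carrier]
    by (intro sum.cong refl) (simp add: sqmat_sum_index sum_distrib_left)
  also have "\<dots> = (\<Sum>l\<in>I. \<Sum>i<n. \<Sum>j<n. cnj (A $$ (i, j)) * F l $$ (i, j))"
    by (simp only: sum.swap[of _ _ I])
  finally show ?thesis using mat_inner_sum[OF A] F by simp
qed

lemma inner_total_operator:
  assumes i: "i \<in> P" and A: "A \<in> strategies \<Gamma> i" and X: "X \<in> profiles \<Gamma>"
  shows "mat_inner A (total_operator \<Gamma> \<Phi> i X) = complex_of_real (\<Sum>j\<in>N i. edge_payoff \<Gamma> i j A (X j))"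
proof -
  have AC: "A \<in> carrier_mat (d i) (d i)" using A by (simp add: strategies_def density_iff)
  have "\<Phi> i j (X j) \<in> carrier_mat (d i) (d i)" if j: "j \<in> N i" for j
    using operator_linear[OF j] profile_carrier[OF X neighborD(3)[OF j]] unfolding op_linear_def by blast
  then have "mat_inner A (total_operator \<Gamma> \<Phi> i X) = (\<Sum>j\<in>N i. mat_inner A (\<Phi> i j (X j)))"
    unfolding total_operator_def by (intro mat_inner_sqmat_sum[OF AC]) blast
  also have "\<dots> = (\<Sum>j\<in>N i. complex_of_real (edge_payoff \<Gamma> i j A (X j)))"
  proof (intro sum.cong refl)
    fix j assume j: "j \<in> N i"
    have "X j \<in> strategies \<Gamma> j"
      using profile_density[OF X neighborD(3)[OF j]] by (simp add: strategies_def)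
    then show "mat_inner A (\<Phi> i j (X j)) = complex_of_real (edge_payoff \<Gamma> i j A (X j))"
      by (rule operator_inner[OF j A])
  qed
  finally show ?thesis by simp
qed

text \<open>
  By the duality with density matrices the operators disappear from the constraints, and only
  the payoffs of player i against X are left.
\<close>

lemma sdp_feasible_iff:
  "(w, X) \<in> sdp_feasible \<Gamma> \<Phi> \<longleftrightarrow> w \<in> P \<rightarrow>\<^sub>E UNIV \<and> X \<in> profiles \<Gamma> \<and>
     (\<forall>i\<in>P. \<forall>A\<in>strategies \<Gamma> i. (\<Sum>j\<in>N i. edge_payoff \<Gamma> i j A (X j)) \<le> w i)"
proof -
  have prof: "X \<in> profiles \<Gamma> \<longleftrightarrow> X \<in> (\<Pi>\<^sub>E i \<in> P. Herm (d i)) \<and>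
      (\<forall>i\<in>P. mat_trace (X i) = 1 \<and> X i \<succeq> 0\<^sub>m (d i) (d i))"
    unfolding profiles_def strategies_def density_def by (auto simp: PiE_iff)
  have ge: "complex_of_real (w i) \<cdot>\<^sub>m 1\<^sub>m (d i) \<succeq> total_operator \<Gamma> \<Phi> i X \<longleftrightarrow>
      (\<forall>A\<in>strategies \<Gamma> i. (\<Sum>j\<in>N i. edge_payoff \<Gamma> i j A (X j)) \<le> w i)"
    if X: "X \<in> profiles \<Gamma>" and i: "i \<in> P" for i
  proof
    assume ge: "complex_of_real (w i) \<cdot>\<^sub>m 1\<^sub>m (d i) \<succeq> total_operator \<Gamma> \<Phi> i X"
    show "\<forall>A\<in>strategies \<Gamma> i. (\<Sum>j\<in>N i. edge_payoff \<Gamma> i j A (X j)) \<le> w i"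
    proof
      fix A assume A: "A \<in> strategies \<Gamma> i"
      then have "A \<in> density (d i)" by (simp add: strategies_def)
      from inner_le_of_scalar_ge[OF this total_operator_carrier ge]
      show "(\<Sum>j\<in>N i. edge_payoff \<Gamma> i j A (X j)) \<le> w i"
        unfolding inner_total_operator[OF i A X] by simp
    qed
  next
    assume le: "\<forall>A\<in>strategies \<Gamma> i. (\<Sum>j\<in>N i. edge_payoff \<Gamma> i j A (X j)) \<le> w i"
    have "Im (mat_inner A (total_operator \<Gamma> \<Phi> i X)) = 0 \<and> Re (mat_inner A (total_operator \<Gamma> \<Phi> i X)) \<le> w i"
      if "A \<in> density (d i)" for A
    proof -
      have A: "A \<in> strategies \<Gamma> i" using that by (simp add: strategies_def)
      show ?thesis unfolding inner_total_operator[OF i A X] using le A by simp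
    qed
    then show "complex_of_real (w i) \<cdot>\<^sub>m 1\<^sub>m (d i) \<succeq> total_operator \<Gamma> \<Phi> i X"
      by (intro scalar_ge_of_inner_le[OF total_operator_carrier]) blast+
  qed
  show ?thesis
    unfolding sdp_feasible_def using prof ge by blast
qed

lemma payoff_le_of_feasible:
  assumes "(w, X) \<in> sdp_feasible \<Gamma> \<Phi>" "i \<in> P"
  shows "payoff \<Gamma> i X \<le> w i"
  using assms unfolding sdp_feasible_iff payoff_def profiles_def by (auto simp: PiE_iff)

text \<open>
  The graph has no loops, so a player's own deviation does not change the opponents' strategies.
\<close>

lemma payoff_deviation:
  "payoff \<Gamma> i (X(i := Y)) = (\<Sum>j\<in>N i. edge_payoff \<Gamma> i j Y (X j))"
  unfolding payoff_def by (intro sum.cong refl) (auto dest: neighborD(4))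

lemma sum_payoff: "X \<in> profiles \<Gamma> \<Longrightarrow> (\<Sum>i\<in>P. payoff \<Gamma> i X) = 0"
  using zero_sum by (simp add: zero_sum_def)

text \<open>
  The payoffs at X are below the bounds w and sum to zero.
\<close>

lemma feasible_value_nonneg:
  assumes "(w, X) \<in> sdp_feasible \<Gamma> \<Phi>"
  shows "0 \<le> sum w P"
proof -
  have "X \<in> profiles \<Gamma>" using assms by (simp add: sdp_feasible_iff)
  then have "0 = (\<Sum>i\<in>P. payoff \<Gamma> i X)" by (simp add: sum_payoff)
  also have "\<dots> \<le> sum w P" by (intro sum_mono payoff_le_of_feasible[OF assms])
  finally show ?thesis .
qed

text \<open>
  At an equilibrium the payoffs themselves are feasible bounds, and they sum to zero. Conversely
  feasible bounds dominate the payoffs; if the two have equal sums they agree for every player,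
  so no deviation pays more than the payoff already earned.
\<close>

lemma nash_iff_feasible_value_zero:
  "X \<in> nash_equilibria \<Gamma> \<longleftrightarrow> (\<exists>w. (w, X) \<in> sdp_feasible \<Gamma> \<Phi> \<and> sum w P = 0)"
proof
  assume X: "X \<in> nash_equilibria \<Gamma>"
  then have XP: "X \<in> profiles \<Gamma>" by (simp add: nash_equilibria_def)
  define w where "w = (\<lambda>i\<in>P. payoff \<Gamma> i X)"
  have "(w, X) \<in> sdp_feasible \<Gamma> \<Phi>"
    using X XP unfolding sdp_feasible_iff nash_equilibria_def payoff_deviation
    by (auto simp: w_def)
  moreover have "sum w P = 0" using sum_payoff[OF XP] by (simp add: w_def)
  ultimately show "\<exists>w. (w, X) \<in> sdp_feasible \<Gamma> \<Phi> \<and> sum w P = 0" by blast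
next
  assume "\<exists>w. (w, X) \<in> sdp_feasible \<Gamma> \<Phi> \<and> sum w P = 0"
  then obtain w where w: "(w, X) \<in> sdp_feasible \<Gamma> \<Phi>" "sum w P = 0" by blast
  have XP: "X \<in> profiles \<Gamma>" using w by (simp add: sdp_feasible_iff)
  have "(\<Sum>i\<in>P. w i - payoff \<Gamma> i X) = 0" using w(2) sum_payoff[OF XP] by (simp add: sum_subtractf)
  then have eq: "w i = payoff \<Gamma> i X" if "i \<in> P" for i
    using payoff_le_of_feasible[OF w(1)] that by (subst (asm) sum_nonneg_eq_0_iff) auto
  then show "X \<in> nash_equilibria \<Gamma>"
    using w(1) XP unfolding sdp_feasible_iff nash_equilibria_def payoff_deviation by auto
qed

text \<open>
  The optimal value of the program is zero: it is never negative, and \<open>near_optimal_bounds\<close> comes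
  arbitrarily close to zero.
\<close>

lemma optimal_iff_value_zero:
  "(w, X) \<in> sdp_optimal \<Gamma> \<Phi> \<longleftrightarrow> (w, X) \<in> sdp_feasible \<Gamma> \<Phi> \<and> sum w P = 0"
proof
  assume opt: "(w, X) \<in> sdp_optimal \<Gamma> \<Phi>"
  then have feas: "(w, X) \<in> sdp_feasible \<Gamma> \<Phi>" by (simp add: sdp_optimal_def)
  have "sum w P \<le> 0 + \<epsilon>" if "0 < \<epsilon>" for \<epsilon>
  proof -
    obtain X' w' where X': "X' \<in> profiles \<Gamma>"
      and w': "\<forall>i\<in>P. \<forall>A\<in>strategies \<Gamma> i. (\<Sum>j\<in>N i. edge_payoff \<Gamma> i j A (X' j)) \<le> w' i" "sum w' P \<le> \<epsilon>"
      using near_optimal_bounds[OF \<open>0 < \<epsilon>\<close>] by blast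
    have "(restrict w' P, X') \<in> sdp_feasible \<Gamma> \<Phi>"
      using X' w'(1) by (simp add: sdp_feasible_iff)
    then have "sum w P \<le> sum (restrict w' P) P"
      using opt unfolding sdp_optimal_def by blast
    then show ?thesis using w'(2) by simp
  qed
  then have "sum w P \<le> 0" by (rule field_le_epsilon)
  then show "(w, X) \<in> sdp_feasible \<Gamma> \<Phi> \<and> sum w P = 0"
    using feas feasible_value_nonneg[OF feas] by simp
next
  assume "(w, X) \<in> sdp_feasible \<Gamma> \<Phi> \<and> sum w P = 0"
  then show "(w, X) \<in> sdp_optimal \<Gamma> \<Phi>"
    unfolding sdp_optimal_def using feasible_value_nonneg by auto
qed

lemma nash_equilibria_eq_projection:
  "nash_equilibria \<Gamma> = {X \<in> profiles \<Gamma>. \<exists>w \<in> P \<rightarrow>\<^sub>E UNIV. (w, X) \<in> sdp_optimal \<Gamma> \<Phi>}"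
  by (intro Set.set_eqI) (auto simp: nash_iff_feasible_value_zero optimal_iff_value_zero sdp_feasible_iff)

end

section \<open>The spectrahedron of equilibria\<close>

lemma Herm_if_inner_real:
  assumes B: "B \<in> carrier_mat n n" and real: "\<forall>A\<in>density n. Im (mat_inner A B) = 0"
  shows "B \<in> Herm n"
proof -
  have "Im (herm_form n (\<lambda>i j. B $$ (i, j)) v) = 0" for v
  proof (cases "(\<Sum>i<n. (cmod (v i))\<^sup>2) > 0")
    case True
    from herm_form_eq_inner_pure[OF True B] obtain A where "A \<in> density n"
      "herm_form n (\<lambda>i j. B $$ (i, j)) v = complex_of_real (\<Sum>i<n. (cmod (v i))\<^sup>2) * mat_inner A B" .
    then show ?thesis using real by (simp del: of_real_sum)
  next
    case False
    moreover have "0 \<le> (\<Sum>i<n. (cmod (v i))\<^sup>2)" by (simp add: sum_nonneg)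
    ultimately have "(\<Sum>i<n. (cmod (v i))\<^sup>2) = 0" by linarith
    then have "v i = 0" if "i < n" for i using that by (simp add: sum_nonneg_eq_0_iff)
    then show ?thesis by (simp add: herm_form_def)
  qed
  then show ?thesis using B herm_if_herm_form_real unfolding Herm_iff by blast
qed

text \<open>
  The spectrahedron is cut out by maps that send every Hermitian matrix to a Hermitian one. The
  payoff operators are described through their action on density matrices, so they are composed
  with the Hermitian part; \<open>operator_Herm\<close> shows that this changes nothing on strategies.
\<close>

definition herm_part :: "complex mat \<Rightarrow> complex mat" where
  "herm_part M = mat (dim_row M) (dim_row M) (\<lambda>(i, j). (M $$ (i, j) + cnj (M $$ (j, i))) / 2)"

lemma herm_part_id:
  assumes M: "M \<in> Herm n"
  shows "herm_part M = M"
proof (rule eq_matI)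
  have MC: "M \<in> carrier_mat n n" using M by (simp add: Herm_iff)
  fix i j assume "i < dim_row M" "j < dim_col M"
  then have ij: "i < n" "j < n" using MC by auto
  then have "cnj (M $$ (j, i)) = M $$ (i, j)" using M unfolding Herm_iff by metis
  then show "herm_part M $$ (i, j) = M $$ (i, j)" using ij MC by (simp add: herm_part_def)
qed (use M in \<open>auto simp: Herm_iff herm_part_def\<close>)

lemma herm_linear_zero: "herm_linear n m (\<lambda>_. 0\<^sub>m m m)"
  unfolding herm_linear_def by (auto simp: Herm_iff)

lemma herm_linear_id: "herm_linear n n (\<lambda>Z. Z)"
  unfolding herm_linear_def by auto

lemma Herm_1_entry:
  assumes "Z \<in> Herm 1"
  shows "cnj (Z $$ (0, 0)) = Z $$ (0, 0)"
proof -
  have "(0::nat) < 1" by simp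
  then have "Z $$ (0, 0) = cnj (Z $$ (0, 0))" using assms unfolding Herm_iff by blast
  then show ?thesis by (rule sym)
qed

lemma herm_linear_scalar_block: "herm_linear 1 m (\<lambda>Z. Z $$ (0, 0) \<cdot>\<^sub>m 1\<^sub>m m)"
proof -
  have "Z $$ (0, 0) \<cdot>\<^sub>m 1\<^sub>m m \<in> Herm m" if "Z \<in> Herm 1" for Z
    using Herm_1_entry[OF that] unfolding Herm_iff by auto
  moreover have "(X + Y) $$ (0, 0) \<cdot>\<^sub>m 1\<^sub>m m = X $$ (0, 0) \<cdot>\<^sub>m 1\<^sub>m m + Y $$ (0, 0) \<cdot>\<^sub>m 1\<^sub>m m"
    if "Y \<in> Herm 1" for X Y
  proof -
    have "Y \<in> carrier_mat 1 1" using that by (simp add: Herm_def)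
    then show ?thesis by (intro eq_matI) (auto simp: distrib_right)
  qed
  moreover have "(c \<cdot>\<^sub>m X) $$ (0, 0) \<cdot>\<^sub>m 1\<^sub>m m = c \<cdot>\<^sub>m (X $$ (0, 0) \<cdot>\<^sub>m 1\<^sub>m m)"
    if "X \<in> Herm 1" for c X
  proof -
    have "X \<in> carrier_mat 1 1" using that by (simp add: Herm_def)
    then show ?thesis by (intro eq_matI) auto
  qed
  ultimately show ?thesis unfolding herm_linear_def by blast
qed

lemma herm_linear_neg_herm_part:
  assumes F: "op_linear n m F"
  shows "herm_linear n m (\<lambda>Z. - herm_part (F Z))"
proof -
  have FC: "F Z \<in> carrier_mat m m" if "Z \<in> Herm n" for Z
    using F that unfolding op_linear_def Herm_iff by blast
  have "- herm_part (F Z) \<in> Herm m" if "Z \<in> Herm n" for Z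
    unfolding Herm_iff using FC[OF that] by (auto simp: herm_part_def add.commute)
  moreover have "- herm_part (F (X + Y)) = - herm_part (F X) + - herm_part (F Y)"
    if XY: "X \<in> Herm n" "Y \<in> Herm n" for X Y
  proof -
    have add: "F (X + Y) = F X + F Y" using F XY unfolding op_linear_def Herm_iff by blast
    show ?thesis
      unfolding add using FC[OF XY(1)] FC[OF XY(2)]
      by (intro eq_matI) (auto simp: herm_part_def field_simps)
  qed
  moreover have "- herm_part (F (complex_of_real c \<cdot>\<^sub>m X)) = complex_of_real c \<cdot>\<^sub>m - herm_part (F X)"
    if X: "X \<in> Herm n" for c X
  proof -
    have scale: "F (complex_of_real c \<cdot>\<^sub>m X) = complex_of_real c \<cdot>\<^sub>m F X"
      using F X unfolding op_linear_def Herm_iff by blast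
    show ?thesis
      unfolding scale using FC[OF X] by (intro eq_matI) (auto simp: herm_part_def field_simps)
  qed
  ultimately show ?thesis unfolding herm_linear_def by blast
qed

text \<open>
  Constraints are numbered from 1 here, so that they can share their numbers with players.
\<close>

lemma spectrahedronI:
  fixes q :: "nat \<Rightarrow> nat" and C :: "nat \<Rightarrow> complex mat" and b :: "nat \<Rightarrow> real"
    and L :: "nat \<Rightarrow> nat \<Rightarrow> complex mat \<Rightarrow> complex mat" and A :: "nat \<Rightarrow> nat \<Rightarrow> complex mat"
  assumes "finite I"
    and "\<forall>k\<in>{1..K}. C k \<in> Herm (q k) \<and> (\<forall>l\<in>I. herm_linear (n l) (q k) (L k l))"
    and "\<forall>m\<in>{1..M}. \<forall>l\<in>I. A m l \<in> Herm (n l)"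
  shows "spectrahedron I n {Z \<in> (\<Pi>\<^sub>E l\<in>I. Herm (n l)).
     (\<forall>k\<in>{1..K}. sqmat_sum (q k) I (\<lambda>l. L k l (Z l)) \<succeq> C k) \<and>
     (\<forall>m\<in>{1..M}. (\<Sum>l\<in>I. mat_inner (A m l) (Z l)) = complex_of_real (b m))}"
proof -
  have shift: "(\<forall>k\<in>{1..K}. Q k) \<longleftrightarrow> (\<forall>k<K. Q (Suc k))" for K :: nat and Q
    unfolding image_Suc_lessThan[symmetric] by auto
  show ?thesis
    unfolding spectrahedron_def
    by (intro conjI assms(1) exI[of _ K] exI[of _ "\<lambda>k. q (Suc k)"] exI[of _ "\<lambda>k. L (Suc k)"]
        exI[of _ "\<lambda>k. C (Suc k)"] exI[of _ M] exI[of _ "\<lambda>m. A (Suc m)"] exI[of _ "\<lambda>m. b (Suc m)"])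
      (use assms(2,3) in \<open>simp_all only: shift\<close>)
qed

lemma mat_inner_one:
  assumes "X \<in> carrier_mat n n"
  shows "mat_inner (1\<^sub>m n) X = mat_trace X"
proof -
  have "mat_inner (1\<^sub>m n) X = (\<Sum>i<n. \<Sum>j<n. if j = i then X $$ (i, i) else 0)"
    unfolding mat_inner_sum[OF one_carrier_mat assms] by (intro sum.cong refl) auto
  then show ?thesis using assms by (simp add: mat_trace_def)
qed

lemma mat_inner_zero: "X \<in> carrier_mat n n \<Longrightarrow> mat_inner (0\<^sub>m n n) X = 0"
  by (simp add: mat_inner_sum[OF zero_carrier_mat])

context sdp_game_operators begin

abbreviation "m \<equiv> num_players \<Gamma>"

text \<open>
  The blocks 1, ..., m of the spectrahedron are the strategies, and block m + i is the 1 by 1 matrix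
  holding w i. The linear matrix inequalities use the same numbering: number k \<le> m says \<open>X k \<succeq> 0\<close>, and
  number m + i is the inequality of player i in the semidefinite program.
\<close>

definition block_dim :: "nat \<Rightarrow> nat" where
  "block_dim l = (if l \<le> m then d l else 1)"

definition lmi_dim :: "nat \<Rightarrow> nat" where
  "lmi_dim k = (if k \<le> m then d k else d (k - m))"

definition lmi_map :: "nat \<Rightarrow> nat \<Rightarrow> complex mat \<Rightarrow> complex mat" where
  "lmi_map k l Z =
     (if k \<le> m then if l = k then Z else 0\<^sub>m (lmi_dim k) (lmi_dim k)
      else if l = k then Z $$ (0, 0) \<cdot>\<^sub>m 1\<^sub>m (lmi_dim k)
      else if l \<in> N (k - m) then - herm_part (\<Phi> (k - m) l Z)
      else 0\<^sub>m (lmi_dim k) (lmi_dim k))"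

text \<open>
  Equations 1, ..., m fix the traces of the strategies; equation m + 1 sets the sum of the w i to
  zero, the optimal value, which replaces the minimisation.
\<close>

definition eq_coeff :: "nat \<Rightarrow> nat \<Rightarrow> complex mat" where
  "eq_coeff e l = (if (if e \<le> m then l = e else m < l) then 1\<^sub>m (block_dim l)
     else 0\<^sub>m (block_dim l) (block_dim l))"

definition equilibrium_spectrahedron :: "(nat \<Rightarrow> complex mat) set" where
  "equilibrium_spectrahedron = {Z \<in> (\<Pi>\<^sub>E l\<in>{1..2 * m}. Herm (block_dim l)).
     (\<forall>k\<in>{1..2 * m}. sqmat_sum (lmi_dim k) {1..2 * m} (\<lambda>l. lmi_map k l (Z l)) \<succeq> 0\<^sub>m (lmi_dim k) (lmi_dim k)) \<and>
     (\<forall>e\<in>{1..Suc m}. (\<Sum>l\<in>{1..2 * m}. mat_inner (eq_coeff e l) (Z l)) = complex_of_real (if e \<le> m then 1 else 0))}"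

lemma players_iff: "i \<in> P \<longleftrightarrow> 1 \<le> i \<and> i \<le> m"
  by (simp add: players_def)

lemma spectrahedron_equilibrium_spectrahedron:
  "spectrahedron {1..2 * m} block_dim equilibrium_spectrahedron"
  unfolding equilibrium_spectrahedron_def
proof (rule spectrahedronI)
  show "\<forall>k\<in>{1..2 * m}. 0\<^sub>m (lmi_dim k) (lmi_dim k) \<in> Herm (lmi_dim k) \<and>
      (\<forall>l\<in>{1..2 * m}. herm_linear (block_dim l) (lmi_dim k) (lmi_map k l))"
  proof (intro ballI conjI)
    fix k l assume k: "k \<in> {1..2 * m}" and l: "l \<in> {1..2 * m}"
    consider "k \<le> m" "l = k" | "k \<le> m" "l \<noteq> k" | "m < k" "l = k" | "m < k" "l \<noteq> k" "l \<in> N (k - m)"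
      | "m < k" "l \<noteq> k" "l \<notin> N (k - m)"
      by linarith
    then show "herm_linear (block_dim l) (lmi_dim k) (lmi_map k l)"
    proof cases
      case 1
      then show ?thesis using herm_linear_id by (simp add: lmi_map_def[abs_def] lmi_dim_def block_dim_def)
    next
      case 2
      then show ?thesis using herm_linear_zero by (simp add: lmi_map_def[abs_def])
    next
      case 3
      then show ?thesis using herm_linear_scalar_block[of "d (k - m)"]
        by (simp add: lmi_map_def[abs_def] lmi_dim_def block_dim_def)
    next
      case 4
      then have "l \<le> m" using neighborD(3) players_iff by blast
      then show ?thesis
        using 4 herm_linear_neg_herm_part[OF operator_linear[OF 4(3)]]
        by (simp add: lmi_map_def[abs_def] lmi_dim_def block_dim_def)
    next
      case 5
      then show ?thesis using herm_linear_zero by (simp add: lmi_map_def[abs_def])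
    qed
  qed (simp add: Herm_iff)
  show "\<forall>e\<in>{1..Suc m}. \<forall>l\<in>{1..2 * m}. eq_coeff e l \<in> Herm (block_dim l)"
    by (auto simp: eq_coeff_def Herm_iff)
qed simp

lemma operator_Herm:
  assumes j: "j \<in> N i" and B: "B \<in> density (d j)"
  shows "\<Phi> i j B \<in> Herm (d i)"
proof (rule Herm_if_inner_real)
  have "B \<in> carrier_mat (d j) (d j)" using B by (simp add: density_iff)
  then show "\<Phi> i j B \<in> carrier_mat (d i) (d i)"
    using operator_linear[OF j] unfolding op_linear_def by blast
  show "\<forall>A\<in>density (d i). Im (mat_inner A (\<Phi> i j B)) = 0"
    using operator_inner[OF j] B by (simp add: strategies_def)
qed

lemma lmi_strategy_block:
  assumes k: "k \<in> P" and Z: "Z k \<in> carrier_mat (d k) (d k)"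
  shows "sqmat_sum (lmi_dim k) {1..2 * m} (\<lambda>l. lmi_map k l (Z l)) = Z k"
proof (rule eq_matI)
  have km: "1 \<le> k" "k \<le> m" using k players_iff by auto
  fix a b assume "a < dim_row (Z k)" "b < dim_col (Z k)"
  then have ab: "a < d k" "b < d k" using Z by auto
  have "sqmat_sum (lmi_dim k) {1..2 * m} (\<lambda>l. lmi_map k l (Z l)) $$ (a, b)
      = (\<Sum>l\<in>{1..2 * m}. lmi_map k l (Z l) $$ (a, b))"
    using ab km by (simp add: sqmat_sum_index lmi_dim_def)
  also have "\<dots> = (\<Sum>l\<in>{1..2 * m}. if l = k then Z k $$ (a, b) else 0)"
    using ab km by (intro sum.cong refl) (simp add: lmi_map_def lmi_dim_def)
  finally show "sqmat_sum (lmi_dim k) {1..2 * m} (\<lambda>l. lmi_map k l (Z l)) $$ (a, b) = Z k $$ (a, b)"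
    using km by simp
qed (use k Z players_iff in \<open>auto simp: sqmat_sum_def lmi_dim_def\<close>)

lemma lmi_value_block:
  assumes i: "i \<in> P" and X: "restrict Z P \<in> profiles \<Gamma>" and w: "Z (m + i) $$ (0, 0) = complex_of_real (w i)"
  shows "sqmat_sum (lmi_dim (m + i)) {1..2 * m} (\<lambda>l. lmi_map (m + i) l (Z l)) =
    complex_of_real (w i) \<cdot>\<^sub>m 1\<^sub>m (d i) - total_operator \<Gamma> \<Phi> i (restrict Z P)"
proof (rule eq_matI)
  let ?T = "total_operator \<Gamma> \<Phi> i (restrict Z P)"
  let ?J = "{1..2 * m}"
  have im: "1 \<le> i" "i \<le> m" using i players_iff by auto
  have dim: "lmi_dim (m + i) = d i" using im by (simp add: lmi_dim_def)
  have T: "?T \<in> carrier_mat (d i) (d i)" by simp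
  fix a b assume "a < dim_row (complex_of_real (w i) \<cdot>\<^sub>m 1\<^sub>m (d i) - ?T)"
    "b < dim_col (complex_of_real (w i) \<cdot>\<^sub>m 1\<^sub>m (d i) - ?T)"
  then have ab: "a < d i" "b < d i" using T by auto
  let ?w = "(complex_of_real (w i) \<cdot>\<^sub>m 1\<^sub>m (d i)) $$ (a, b)"
  have block: "lmi_map (m + i) l (Z l) $$ (a, b) =
      (if l = m + i then ?w else 0) + (if l \<in> N i then - (\<Phi> i l (restrict Z P l) $$ (a, b)) else 0)" for l
  proof (cases "l \<in> N i")
    case True
    then have l: "l \<in> P" "l \<noteq> m + i" using neighborD(3) im players_iff by force+
    have "Z l \<in> density (d l)" using profile_density[OF X l(1)] l(1) by simp
    then have H: "\<Phi> i l (Z l) \<in> Herm (d i)" by (rule operator_Herm[OF True])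
    then have "herm_part (\<Phi> i l (Z l)) = \<Phi> i l (Z l)" "\<Phi> i l (Z l) \<in> carrier_mat (d i) (d i)"
      by (auto simp: herm_part_id Herm_iff)
    then show ?thesis using True l im ab by (simp add: lmi_map_def)
  next
    case False
    then show ?thesis using im ab w by (simp add: lmi_map_def dim)
  qed
  have sub: "N i \<subseteq> ?J" using neighborD(3) players_iff by force
  have "sqmat_sum (lmi_dim (m + i)) ?J (\<lambda>l. lmi_map (m + i) l (Z l)) $$ (a, b)
      = (\<Sum>l\<in>?J. if l = m + i then ?w else 0)
        + (\<Sum>l\<in>?J. if l \<in> N i then - (\<Phi> i l (restrict Z P l) $$ (a, b)) else 0)"
    using ab by (simp only: dim sqmat_sum_index block sum.distrib)
  also have "(\<Sum>l\<in>?J. if l = m + i then ?w else 0) = ?w" using im by simp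
  also have "(\<Sum>l\<in>?J. if l \<in> N i then - (\<Phi> i l (restrict Z P l) $$ (a, b)) else 0)
      = (\<Sum>l\<in>N i. - (\<Phi> i l (restrict Z P l) $$ (a, b)))"
    using sub by (simp add: sum.If_cases Int_absorb1)
  also have "\<dots> = - (?T $$ (a, b))"
    using ab by (simp add: total_operator_def sqmat_sum_index sum_negf)
  finally show "sqmat_sum (lmi_dim (m + i)) ?J (\<lambda>l. lmi_map (m + i) l (Z l)) $$ (a, b) =
      (complex_of_real (w i) \<cdot>\<^sub>m 1\<^sub>m (d i) - ?T) $$ (a, b)"
    using ab carrier_matD[OF T] by simp
qed (use i players_iff in \<open>auto simp: sqmat_sum_def lmi_dim_def total_operator_def\<close>)

lemma all_blocks_iff:
  "(\<forall>k\<in>{1..2 * m}. Q k) \<longleftrightarrow> (\<forall>i\<in>P. Q i) \<and> (\<forall>i\<in>P. Q (m + i))"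
proof -
  have "{1..2 * m} = P \<union> (\<lambda>i. m + i) ` P"
  proof -
    have "k \<in> P \<union> (\<lambda>i. m + i) ` P" if "k \<in> {1..2 * m}" for k
    proof (cases "k \<le> m")
      case True
      then show ?thesis using that by (simp add: players_iff)
    next
      case False
      then have "k = m + (k - m)" "k - m \<in> P" using that by (auto simp: players_iff)
      then show ?thesis by blast
    qed
    moreover have "P \<union> (\<lambda>i. m + i) ` P \<subseteq> {1..2 * m}" by (auto simp: players_iff)
    ultimately show ?thesis by blast
  qed
  then show ?thesis by auto
qed

lemma equation_trace:
  assumes Z: "Z \<in> (\<Pi>\<^sub>E l\<in>{1..2 * m}. Herm (block_dim l))" and e: "e \<in> P"
  shows "(\<Sum>l\<in>{1..2 * m}. mat_inner (eq_coeff e l) (Z l)) = mat_trace (Z e)"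
proof -
  have em: "1 \<le> e" "e \<le> m" using e players_iff by auto
  have ZC: "Z l \<in> carrier_mat (block_dim l) (block_dim l)" if "l \<in> {1..2 * m}" for l
    using Z that by (auto simp: PiE_iff Herm_iff)
  have "(\<Sum>l\<in>{1..2 * m}. mat_inner (eq_coeff e l) (Z l)) =
      (\<Sum>l\<in>{1..2 * m}. if l = e then mat_trace (Z e) else 0)"
    using em by (intro sum.cong refl) (simp add: eq_coeff_def mat_inner_one[OF ZC] mat_inner_zero[OF ZC])
  then show ?thesis using em by simp
qed

lemma equation_value:
  assumes Z: "Z \<in> (\<Pi>\<^sub>E l\<in>{1..2 * m}. Herm (block_dim l))"
  shows "(\<Sum>l\<in>{1..2 * m}. mat_inner (eq_coeff (Suc m) l) (Z l)) = (\<Sum>i\<in>P. Z (m + i) $$ (0, 0))"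
proof -
  have ZC: "Z l \<in> carrier_mat (block_dim l) (block_dim l)" if "l \<in> {1..2 * m}" for l
    using Z that by (auto simp: PiE_iff Herm_iff)
  have "(\<Sum>l\<in>{1..2 * m}. mat_inner (eq_coeff (Suc m) l) (Z l)) =
      (\<Sum>l\<in>{1..2 * m}. if l \<in> {m + 1..2 * m} then Z l $$ (0, 0) else 0)"
  proof (intro sum.cong refl)
    fix l assume l: "l \<in> {1..2 * m}"
    show "mat_inner (eq_coeff (Suc m) l) (Z l) = (if l \<in> {m + 1..2 * m} then Z l $$ (0, 0) else 0)"
    proof (cases "m < l")
      case True
      then have "mat_trace (Z l) = Z l $$ (0, 0)"
        using ZC[OF l] by (simp add: mat_trace_def block_dim_def)
      then show ?thesis using True l by (simp add: eq_coeff_def mat_inner_one[OF ZC[OF l]])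
    next
      case False
      then show ?thesis using l by (simp add: eq_coeff_def mat_inner_zero[OF ZC[OF l]])
    qed
  qed
  also have "\<dots> = (\<Sum>l\<in>{m + 1..2 * m}. Z l $$ (0, 0))"
    by (rule sum.mono_neutral_cong_right) auto
  also have "\<dots> = (\<Sum>i\<in>P. Z (m + i) $$ (0, 0))"
    by (rule sum.reindex_bij_witness[of _ "\<lambda>i. m + i" "\<lambda>l. l - m"]) (auto simp: players_iff)
  finally show ?thesis .
qed

text \<open>
  Block by block, the inequalities and equations are those of the program. The inequality of a player
  can be compared only once the strategies are known to be density matrices, because only then
  does the Hermitian part of a payoff operator agree with the operator itself.
\<close>

lemma equilibrium_spectrahedron_iff:
  assumes Z: "Z \<in> (\<Pi>\<^sub>E l\<in>{1..2 * m}. Herm (block_dim l))"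
    and w: "w \<in> P \<rightarrow>\<^sub>E UNIV" "\<forall>i\<in>P. Z (m + i) $$ (0, 0) = complex_of_real (w i)"
  shows "Z \<in> equilibrium_spectrahedron \<longleftrightarrow> (w, restrict Z P) \<in> sdp_feasible \<Gamma> \<Phi> \<and> sum w P = 0"
proof -
  let ?X = "restrict Z P"
  have ZP: "Z i \<in> Herm (d i)" if "i \<in> P" for i
    using Z that players_iff[of i] by (force simp: PiE_iff block_dim_def)
  have dimP: "lmi_dim i = d i" "lmi_dim (m + i) = d i" if "i \<in> P" for i
    using that players_iff by (auto simp: lmi_dim_def)
  have prof: "?X \<in> profiles \<Gamma> \<longleftrightarrow> (\<forall>i\<in>P. Z i \<succeq> 0\<^sub>m (d i) (d i)) \<and> (\<forall>i\<in>P. mat_trace (Z i) = 1)"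
    using ZP by (auto simp: profiles_def strategies_def density_def)
  have block: "sqmat_sum (lmi_dim i) {1..2 * m} (\<lambda>l. lmi_map i l (Z l)) = Z i" if "i \<in> P" for i
    by (rule lmi_strategy_block[OF that]) (use ZP[OF that] in \<open>simp add: Herm_iff\<close>)
  have value_block: "sqmat_sum (lmi_dim (m + i)) {1..2 * m} (\<lambda>l. lmi_map (m + i) l (Z l)) \<succeq> 0\<^sub>m (d i) (d i)
      \<longleftrightarrow> complex_of_real (w i) \<cdot>\<^sub>m 1\<^sub>m (d i) \<succeq> total_operator \<Gamma> \<Phi> i ?X"
    if X: "?X \<in> profiles \<Gamma>" and i: "i \<in> P" for i
  proof -
    let ?D = "complex_of_real (w i) \<cdot>\<^sub>m 1\<^sub>m (d i) - total_operator \<Gamma> \<Phi> i ?X"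
    have minus_zero: "D - 0\<^sub>m k k = D" if "D \<in> carrier_mat k k" for D :: "complex mat" and k
      using that by auto
    have "?D - 0\<^sub>m (d i) (d i) = ?D"
      by (rule minus_zero[OF minus_carrier_mat[OF total_operator_carrier]])
    then show ?thesis using lmi_value_block[OF i X] w(2) i by (simp add: psd_ge_def)
  qed
  have eqs: "(\<forall>e\<in>{1..Suc m}. (\<Sum>l\<in>{1..2 * m}. mat_inner (eq_coeff e l) (Z l)) = complex_of_real (if e \<le> m then 1 else 0))
      \<longleftrightarrow> (\<forall>i\<in>P. mat_trace (Z i) = 1) \<and> sum w P = 0"
  proof -
    have "{1..Suc m} = insert (Suc m) P" by (auto simp: players_def)
    moreover have "(\<Sum>l\<in>{1..2 * m}. mat_inner (eq_coeff (Suc m) l) (Z l)) = complex_of_real (sum w P)"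
      unfolding equation_value[OF Z] using w(2) by simp
    moreover have "(\<forall>e\<in>P. (\<Sum>l\<in>{1..2 * m}. mat_inner (eq_coeff e l) (Z l)) = complex_of_real (if e \<le> m then 1 else 0))
        \<longleftrightarrow> (\<forall>i\<in>P. mat_trace (Z i) = 1)"
      using equation_trace[OF Z] by (simp add: players_iff)
    ultimately show ?thesis
      by (simp only: ball_simps) (auto simp del: of_real_sum)
  qed
  have strat: "(\<forall>i\<in>P. sqmat_sum (lmi_dim i) {1..2 * m} (\<lambda>l. lmi_map i l (Z l)) \<succeq> 0\<^sub>m (lmi_dim i) (lmi_dim i))
      \<longleftrightarrow> (\<forall>i\<in>P. Z i \<succeq> 0\<^sub>m (d i) (d i))"
    by (intro ball_cong refl) (simp only: block, simp only: dimP)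
  have val: "(\<forall>i\<in>P. sqmat_sum (lmi_dim (m + i)) {1..2 * m} (\<lambda>l. lmi_map (m + i) l (Z l)) \<succeq> 0\<^sub>m (lmi_dim (m + i)) (lmi_dim (m + i)))
      \<longleftrightarrow> (\<forall>i\<in>P. sqmat_sum (lmi_dim (m + i)) {1..2 * m} (\<lambda>l. lmi_map (m + i) l (Z l)) \<succeq> 0\<^sub>m (d i) (d i))"
    by (intro ball_cong refl) (simp only: dimP)
  have "Z \<in> equilibrium_spectrahedron \<longleftrightarrow>
      (\<forall>i\<in>P. Z i \<succeq> 0\<^sub>m (d i) (d i)) \<and>
      (\<forall>i\<in>P. sqmat_sum (lmi_dim (m + i)) {1..2 * m} (\<lambda>l. lmi_map (m + i) l (Z l)) \<succeq> 0\<^sub>m (d i) (d i)) \<and>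
      (\<forall>i\<in>P. mat_trace (Z i) = 1) \<and> sum w P = 0"
    unfolding equilibrium_spectrahedron_def mem_Collect_eq eqs all_blocks_iff strat val using Z by blast
  also have "\<dots> \<longleftrightarrow> ?X \<in> profiles \<Gamma> \<and>
      (\<forall>i\<in>P. complex_of_real (w i) \<cdot>\<^sub>m 1\<^sub>m (d i) \<succeq> total_operator \<Gamma> \<Phi> i ?X) \<and> sum w P = 0"
    using prof value_block by blast
  also have "\<dots> \<longleftrightarrow> (w, ?X) \<in> sdp_feasible \<Gamma> \<Phi> \<and> sum w P = 0"
    using w(1) ZP by (auto simp: sdp_feasible_def prof)
  finally show ?thesis .
qed

lemma nash_equilibria_eq_restrict:
  "nash_equilibria \<Gamma> = (\<lambda>Z. restrict Z P) ` equilibrium_spectrahedron"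
proof (intro equalityI subsetI)
  fix X assume "X \<in> nash_equilibria \<Gamma>"
  then obtain w where w: "(w, X) \<in> sdp_feasible \<Gamma> \<Phi>" "sum w P = 0"
    using nash_iff_feasible_value_zero by blast
  then have wP: "w \<in> P \<rightarrow>\<^sub>E UNIV" and X: "X \<in> (\<Pi>\<^sub>E i \<in> P. Herm (d i))"
    by (auto simp: sdp_feasible_def)
  define Z where "Z = (\<lambda>l\<in>{1..2 * m}. if l \<le> m then X l else mat 1 1 (\<lambda>_. complex_of_real (w (l - m))))"
  have Z: "Z \<in> (\<Pi>\<^sub>E l\<in>{1..2 * m}. Herm (block_dim l))"
  proof (rule PiE_I)
    fix l assume l: "l \<in> {1..2 * m}"
    have "mat 1 1 (\<lambda>_. complex_of_real r) \<in> Herm 1" for r by (simp add: Herm_iff)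
    moreover have "X l \<in> Herm (d l)" if "l \<le> m"
      using X that l by (simp add: PiE_iff players_iff)
    ultimately show "Z l \<in> Herm (block_dim l)" using l by (simp add: Z_def block_dim_def)
  qed (simp only: Z_def restrict_apply if_False)
  have ZX: "restrict Z P = X"
    using X by (auto simp: Z_def PiE_iff players_iff extensional_def restrict_def fun_eq_iff)
  have "\<forall>i\<in>P. Z (m + i) $$ (0, 0) = complex_of_real (w i)"
    by (auto simp: Z_def players_iff)
  then have "Z \<in> equilibrium_spectrahedron"
    using equilibrium_spectrahedron_iff[OF Z wP] w unfolding ZX by blast
  then show "X \<in> (\<lambda>Z. restrict Z P) ` equilibrium_spectrahedron" using ZX by blast
next
  fix X assume "X \<in> (\<lambda>Z. restrict Z P) ` equilibrium_spectrahedron"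
  then obtain Z where ZS: "Z \<in> equilibrium_spectrahedron" and X: "X = restrict Z P" by blast
  then have Z: "Z \<in> (\<Pi>\<^sub>E l\<in>{1..2 * m}. Herm (block_dim l))" by (simp add: equilibrium_spectrahedron_def)
  define w where "w = (\<lambda>i\<in>P. Re (Z (m + i) $$ (0, 0)))"
  have "\<forall>i\<in>P. Z (m + i) $$ (0, 0) = complex_of_real (w i)"
  proof
    fix i assume i: "i \<in> P"
    then have "m + i \<in> {1..2 * m}" "\<not> m + i \<le> m" using players_iff[of i] by auto
    with PiE_mem[OF Z this(1)] have "Z (m + i) \<in> Herm 1" by (simp add: block_dim_def)
    from arg_cong[OF Herm_1_entry[OF this], of Im] have "Im (Z (m + i) $$ (0, 0)) = 0" by simp
    then show "Z (m + i) $$ (0, 0) = complex_of_real (w i)"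
      using i by (simp add: w_def complex_eq_iff)
  qed
  then show "X \<in> nash_equilibria \<Gamma>"
    using equilibrium_spectrahedron_iff[OF Z, of w] ZS X nash_iff_feasible_value_zero by (auto simp: w_def)
qed

lemma sdp_representable_nash_equilibria: "sdp_representable P d (nash_equilibria \<Gamma>)"
  unfolding sdp_representable_def
proof (intro exI conjI)
  show "P \<subseteq> {1..2 * m}" by (auto simp: players_iff)
  show "\<forall>l\<in>P. block_dim l = d l" by (simp add: block_dim_def players_iff)
qed (fact spectrahedron_equilibrium_spectrahedron nash_equilibria_eq_restrict)+

end

theorem theorem4p5:
  fixes \<Gamma> :: sdp_network_game
    and \<Phi> :: "nat \<Rightarrow> nat \<Rightarrow> complex mat \<Rightarrow> complex mat"
  assumes "semidefinite_network_game \<Gamma>"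
    and "zero_sum \<Gamma>"
    and "payoff_operators \<Gamma> \<Phi>"
  shows "nash_equilibria \<Gamma> =
           {X \<in> profiles \<Gamma>. \<exists>w \<in> players \<Gamma> \<rightarrow>\<^sub>E UNIV. (w, X) \<in> sdp_optimal \<Gamma> \<Phi>}
         \<and> sdp_representable (players \<Gamma>) (strat_dim \<Gamma>) (nash_equilibria \<Gamma>)"
proof -
  interpret sdp_game_operators \<Gamma> \<Phi>
    using assms by unfold_locales
  show ?thesis
    using nash_equilibria_eq_projection sdp_representable_nash_equilibria by blast
qed

end
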